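(* Let $(M_1^{n_1},F_1)$ and $(M_2^{n_2},F_2)$ be Finsler manifolds of finite maximum (respectively, minimum) volume, and let $f$ be a smooth function on $M_1$ such that $a\le f\le b$ for some constants $a,b>0$. Then the Finsler warped product $M=M_1\times_f M_2$, with base $M_1$ and fiber $M_2$, also has finite maximum (respectively, minimum) volume.
   Context: A Finsler metric on a smooth manifold $M$ is a continuous $F:TM\to[0,\infty)$, smooth on $TM^0=TM\setminus\{0\}$, positively 1-homogeneous on fibers, with $g_{ij}=\frac12\frac{\partial^2F^2}{\partial y^i\partial y^j}$ positive definite on $TM^0$. The maximum and minimum volume forms are $dV_{\max}=\sigma_{\max}(x)\,dx$ and $dV_{\min}=\sigma_{\min}(x)\,dx$, where $\sigma_{\max}(x)=\max_{y\in I_x}\sqrt{\det(g_{ij}(x,y))}$, $\sigma_{\min}(x)=\min_{y\in I_x}\sqrt{\det(g_{ij}(x,y))}$ and $I_x=\{y\in T_xM: F(x,y)=1\}$ is the indicatrix. The Finsler warped product $M=M_1\times_f M_2$ of a base $(M_1,F_1)$ and fiber $(M_2,F_2)$ with warping function $f>0$ smooth on $M_1$ is $M_1\times M_2$ with $F^2(x_1,y_1,x_2,y_2)=F_1^2(x_1,y_1)+f^2(x_1)F_2^2(x_2,y_2)$ on $TM_1^0\times TM_2^0$ (so the maximum and minimum over its indicatrix are taken over vectors $(y_1,y_2)$ with $y_1\ne0$, $y_2\neq 0$); its fundamental tensor is block diagonal with blocks $g_{ij}(x_1,y_1)$ and $f^2(x_1)g_{\alpha\beta}(x_2,y_2)$,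 where $g_{ij},g_{\alpha\beta}$ are the fundamental tensors of $F_1,F_2$. *)

theory Defs
  imports "HOL-Analysis.Analysis"
begin

section \<open>Smooth maps between normed spaces\<close>

text \<open>Both notions are meant for open sets: derivatives are taken at \<open>x\<close>, not within \<open>S\<close>.\<close>

primrec Ck_on :: "nat \<Rightarrow> 'a::real_normed_vector set \<Rightarrow> ('a \<Rightarrow> 'b::real_normed_vector) \<Rightarrow> bool" where
  "Ck_on 0 S h \<longleftrightarrow> continuous_on S h"
| "Ck_on (Suc k) S h \<longleftrightarrow>
     (\<forall>x\<in>S. h differentiable at x) \<and> (\<forall>v. Ck_on k S (\<lambda>x. frechet_derivative h (at x) v))"

definition smooth_on :: "'a::real_normed_vector set \<Rightarrow> ('a \<Rightarrow> 'b::real_normed_vector) \<Rightarrow> bool" where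
  "smooth_on S h \<longleftrightarrow> (\<forall>k. Ck_on k S h)"


section \<open>Smooth manifolds\<close>

text \<open>
  A smooth manifold of dimension \<open>CARD('n)\<close> is a Hausdorff, second countable topological space
  (the whole type \<open>'m\<close>) together with a smooth atlas, which is not required to be maximal.
  The values of \<open>chart_map c\<close> outside \<open>chart_dom c\<close> are irrelevant.
\<close>

datatype ('m, 'n::finite) chart = Chart (chart_dom: "'m set") (chart_map: "'m \<Rightarrow> real^'n")

definition chart_inv :: "('m, 'n::finite) chart \<Rightarrow> real^'n \<Rightarrow> 'm" where
  "chart_inv c = inv_into (chart_dom c) (chart_map c)"

abbreviation chart_image :: "('m, 'n::finite) chart \<Rightarrow> (real^'n) set" where
  "chart_image c \<equiv> chart_map c ` chart_dom c"

definition is_chart :: "('m::topological_space, 'n::finite) chart \<Rightarrow> bool" where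
  "is_chart c \<longleftrightarrow> open (chart_dom c) \<and> open (chart_image c) \<and>
     homeomorphism (chart_dom c) (chart_image c) (chart_map c) (chart_inv c)"

definition smooth_atlas ::
    "('m::{t2_space, second_countable_topology}, 'n::finite) chart set \<Rightarrow> bool" where
  "smooth_atlas A \<longleftrightarrow> (\<forall>c\<in>A. is_chart c) \<and> (\<Union>c\<in>A. chart_dom c) = UNIV \<and>
     (\<forall>c\<in>A. \<forall>d\<in>A.
        smooth_on (chart_map c ` (chart_dom c \<inter> chart_dom d)) (chart_map d \<circ> chart_inv c))"

definition smooth_function ::
    "('m, 'n::finite) chart set \<Rightarrow> ('m \<Rightarrow> real) \<Rightarrow> bool" where
  "smooth_function A f \<longleftrightarrow> (\<forall>c\<in>A. smooth_on (chart_image c) (f \<circ> chart_inv c))"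

text \<open>
  A tangent vector at \<open>p\<close> assigns to every chart around \<open>p\<close> its coordinate vector in that chart,
  subject to the usual transformation law; the value \<open>0\<close> at all other charts is a convention
  that makes tangent vectors at \<open>p\<close> determined by their coordinates.
\<close>

type_synonym ('m, 'n) tvec = "('m, 'n) chart \<Rightarrow> real^'n"

definition tangent_space :: "('m, 'n::finite) chart set \<Rightarrow> 'm \<Rightarrow> ('m, 'n) tvec set" where
  "tangent_space A p = {v.
     (\<forall>c\<in>A. \<forall>d\<in>A. p \<in> chart_dom c \<longrightarrow> p \<in> chart_dom d \<longrightarrow>
        v d = frechet_derivative (chart_map d \<circ> chart_inv c) (at (chart_map c p)) (v c)) \<and>
     (\<forall>c. \<not> (c \<in> A \<and> p \<in> chart_dom c) \<longrightarrow> v c = 0)}"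

text \<open>The tangent vector at \<open>p\<close> whose coordinate vector in the chart \<open>c\<close> around \<open>p\<close> is \<open>y\<close>.\<close>

definition coord_vector ::
    "('m, 'n::finite) chart set \<Rightarrow> ('m, 'n) chart \<Rightarrow> 'm \<Rightarrow> real^'n \<Rightarrow> ('m, 'n) tvec" where
  "coord_vector A c p y = (\<lambda>d. if d \<in> A \<and> p \<in> chart_dom d
     then frechet_derivative (chart_map d \<circ> chart_inv c) (at (chart_map c p)) y else 0)"

text \<open>
  The differential at \<open>p\<close> of a map \<open>h\<close> between manifolds. For differentiable \<open>h\<close> and \<open>v\<close> a tangent
  vector at \<open>p\<close> it does not depend on the choice of the chart \<open>c\<close> around \<open>p\<close>.
\<close>

definition differential ::
    "('m, 'n::finite) chart set \<Rightarrow> ('k, 'l::finite) chart set \<Rightarrow> ('m \<Rightarrow> 'k) \<Rightarrow> 'm \<Rightarrow>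
     ('m, 'n) tvec \<Rightarrow> ('k, 'l) tvec" where
  "differential A B h p v =
     (let c = (SOME c. c \<in> A \<and> p \<in> chart_dom c) in
      (\<lambda>d. if d \<in> B \<and> h p \<in> chart_dom d
           then frechet_derivative (chart_map d \<circ> h \<circ> chart_inv c) (at (chart_map c p)) (v c)
           else 0))"

definition vec_join :: "real^'n \<Rightarrow> real^'l \<Rightarrow> real^('n::finite + 'l::finite)" where
  "vec_join x y = (\<chi> i. case i of Inl j \<Rightarrow> x $ j | Inr j \<Rightarrow> y $ j)"

definition prod_chart ::
    "('m, 'n::finite) chart \<Rightarrow> ('k, 'l::finite) chart \<Rightarrow> ('m \<times> 'k, 'n + 'l) chart" where
  "prod_chart c d = Chart (chart_dom c \<times> chart_dom d)
     (\<lambda>(p, q). vec_join (chart_map c p) (chart_map d q))"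

definition prod_atlas ::
    "('m, 'n::finite) chart set \<Rightarrow> ('k, 'l::finite) chart set \<Rightarrow> ('m \<times> 'k, 'n + 'l) chart set" where
  "prod_atlas A B = {prod_chart c d | c d. c \<in> A \<and> d \<in> B}"


section \<open>Finsler metrics\<close>

text \<open>A function on the tangent bundle is written in curried form \<open>F p v\<close>, with \<open>v\<close> tangent at \<open>p\<close>.\<close>

type_synonym ('m, 'n) tm_fun = "'m \<Rightarrow> ('m, 'n) tvec \<Rightarrow> real"

definition coord_expr ::
    "('m, 'n::finite) chart set \<Rightarrow> ('m, 'n) tm_fun \<Rightarrow> ('m, 'n) chart \<Rightarrow>
     (real^'n) \<times> (real^'n) \<Rightarrow> real" where
  "coord_expr A F c = (\<lambda>(x, y). F (chart_inv c x) (coord_vector A c (chart_inv c x) y))"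

definition partial_deriv :: "'n::finite \<Rightarrow> (real^'n \<Rightarrow> real) \<Rightarrow> real^'n \<Rightarrow> real" where
  "partial_deriv i h y = deriv (\<lambda>t. h (y + t *\<^sub>R axis i 1)) 0"

definition fundamental_tensor ::
    "('m, 'n::finite) chart set \<Rightarrow> ('m, 'n) tm_fun \<Rightarrow> ('m, 'n) chart \<Rightarrow> 'm \<Rightarrow> real^'n \<Rightarrow>
     real^'n^'n" where
  "fundamental_tensor A F c p y =
     (\<chi> i j. 1/2 * partial_deriv i (partial_deriv j (\<lambda>z. (F p (coord_vector A c p z))\<^sup>2)) y)"

definition finsler_metric ::
    "('m::topological_space, 'n::finite) chart set \<Rightarrow> ('m, 'n) tm_fun \<Rightarrow> bool" where
  "finsler_metric A F \<longleftrightarrow>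
     (\<forall>p. \<forall>v\<in>tangent_space A p. 0 \<le> F p v) \<and>
     (\<forall>p. \<forall>v\<in>tangent_space A p. \<forall>r>0. F p (\<lambda>c. r *\<^sub>R v c) = r * F p v) \<and>
     (\<forall>c\<in>A. continuous_on (chart_image c \<times> UNIV) (coord_expr A F c)) \<and>
     (\<forall>c\<in>A. smooth_on (chart_image c \<times> (UNIV - {0})) (coord_expr A F c)) \<and>
     (\<forall>c\<in>A. \<forall>p\<in>chart_dom c. \<forall>y. y \<noteq> 0 \<longrightarrow>
        (\<forall>w. w \<noteq> 0 \<longrightarrow> 0 < w \<bullet> (fundamental_tensor A F c p y *v w)))"


section \<open>Maximum and minimum volume\<close>

text \<open>
  The parameter \<open>D\<close> gives, for each point, the tangent vectors at which the metric is regular.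
  It is the complement of the zero section for a Finsler metric, and the set of vectors with two
  nonzero components for a warped product.
\<close>

definition slit_tangent :: "('m, 'n::finite) chart set \<Rightarrow> 'm \<Rightarrow> ('m, 'n) tvec set" where
  "slit_tangent A p = tangent_space A p - {\<lambda>c. 0}"

definition indicatrix ::
    "('m \<Rightarrow> ('m, 'n::finite) tvec set) \<Rightarrow> ('m, 'n) tm_fun \<Rightarrow> 'm \<Rightarrow> ('m, 'n) tvec set" where
  "indicatrix D F p = {v \<in> D p. F p v = 1}"

definition sigma_max ::
    "('m, 'n::finite) chart set \<Rightarrow> ('m \<Rightarrow> ('m, 'n) tvec set) \<Rightarrow> ('m, 'n) tm_fun \<Rightarrow>
     ('m, 'n) chart \<Rightarrow> 'm \<Rightarrow> real" where
  "sigma_max A D F c p =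
     (GREATEST s. \<exists>v\<in>indicatrix D F p. s = sqrt (det (fundamental_tensor A F c p (v c))))"

definition sigma_min ::
    "('m, 'n::finite) chart set \<Rightarrow> ('m \<Rightarrow> ('m, 'n) tvec set) \<Rightarrow> ('m, 'n) tm_fun \<Rightarrow>
     ('m, 'n) chart \<Rightarrow> 'm \<Rightarrow> real" where
  "sigma_min A D F c p =
     (LEAST s. \<exists>v\<in>indicatrix D F p. s = sqrt (det (fundamental_tensor A F c p (v c))))"

text \<open>
  \<open>is_volume_measure A \<sigma> \<mu>\<close> says that \<open>\<mu>\<close> is the Borel measure given by the volume form which in
  each chart \<open>c\<close> reads \<open>\<sigma> c p dx\<close>. Since countably many chart domains cover the manifold,
  there is at most one such \<open>\<mu>\<close>.
\<close>

definition is_volume_measure ::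
    "('m::topological_space, 'n::finite) chart set \<Rightarrow> (('m, 'n) chart \<Rightarrow> 'm \<Rightarrow> real) \<Rightarrow>
     'm measure \<Rightarrow> bool" where
  "is_volume_measure A \<sigma> \<mu> \<longleftrightarrow> sets \<mu> = sets borel \<and>
     (\<forall>c\<in>A. \<forall>B\<in>sets borel. B \<subseteq> chart_dom c \<longrightarrow>
        emeasure \<mu> B = (\<integral>\<^sup>+x\<in>chart_map c ` B. ennreal (\<sigma> c (chart_inv c x)) \<partial>lborel))"

definition finite_volume ::
    "('m::topological_space, 'n::finite) chart set \<Rightarrow> (('m, 'n) chart \<Rightarrow> 'm \<Rightarrow> real) \<Rightarrow> bool" where
  "finite_volume A \<sigma> \<longleftrightarrow> (\<exists>\<mu>. is_volume_measure A \<sigma> \<mu> \<and> emeasure \<mu> UNIV < \<infinity>)"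

definition finite_max_volume ::
    "('m::topological_space, 'n::finite) chart set \<Rightarrow> ('m \<Rightarrow> ('m, 'n) tvec set) \<Rightarrow>
     ('m, 'n) tm_fun \<Rightarrow> bool" where
  "finite_max_volume A D F \<longleftrightarrow> finite_volume A (sigma_max A D F)"

definition finite_min_volume ::
    "('m::topological_space, 'n::finite) chart set \<Rightarrow> ('m \<Rightarrow> ('m, 'n) tvec set) \<Rightarrow>
     ('m, 'n) tm_fun \<Rightarrow> bool" where
  "finite_min_volume A D F \<longleftrightarrow> finite_volume A (sigma_min A D F)"


section \<open>Warped products\<close>

definition dproj1 ::
    "('m, 'n::finite) chart set \<Rightarrow> ('k, 'l::finite) chart set \<Rightarrow> 'm \<times> 'k \<Rightarrow>
     ('m \<times> 'k, 'n + 'l) tvec \<Rightarrow> ('m, 'n) tvec" where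
  "dproj1 A1 A2 = differential (prod_atlas A1 A2) A1 fst"

definition dproj2 ::
    "('m, 'n::finite) chart set \<Rightarrow> ('k, 'l::finite) chart set \<Rightarrow> 'm \<times> 'k \<Rightarrow>
     ('m \<times> 'k, 'n + 'l) tvec \<Rightarrow> ('k, 'l) tvec" where
  "dproj2 A1 A2 = differential (prod_atlas A1 A2) A2 snd"

definition warped_metric ::
    "('m, 'n::finite) chart set \<Rightarrow> ('m, 'n) tm_fun \<Rightarrow> ('m \<Rightarrow> real) \<Rightarrow>
     ('k, 'l::finite) chart set \<Rightarrow> ('k, 'l) tm_fun \<Rightarrow> ('m \<times> 'k, 'n + 'l) tm_fun" where
  "warped_metric A1 F1 f A2 F2 = (\<lambda>p v.
     sqrt ((F1 (fst p) (dproj1 A1 A2 p v))\<^sup>2 + (f (fst p))\<^sup>2 * (F2 (snd p) (dproj2 A1 A2 p v))\<^sup>2))"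

definition warped_slit_tangent ::
    "('m, 'n::finite) chart set \<Rightarrow> ('k, 'l::finite) chart set \<Rightarrow> 'm \<times> 'k \<Rightarrow>
     ('m \<times> 'k, 'n + 'l) tvec set" where
  "warped_slit_tangent A1 A2 p = {v \<in> tangent_space (prod_atlas A1 A2) p.
     dproj1 A1 A2 p v \<noteq> (\<lambda>c. 0) \<and> dproj2 A1 A2 p v \<noteq> (\<lambda>c. 0)}"

end

theory Submission
  imports Defs
begin

text \<open>
  In a product chart the fundamental tensor of the warped product is block diagonal with blocks
  \<open>g\<^sub>1(y\<^sub>1)\<close> and \<open>f\<^sup>2 g\<^sub>2(y\<^sub>2)\<close>, so the square root of its determinant is \<open>f\<^bsup>l\<^esup>\<close> times the
  product of those of \<open>g\<^sub>1\<close> and \<open>g\<^sub>2\<close>, where \<open>l\<close> is the dimension of the fiber. The fundamental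
  tensor is 0-homogeneous, so the extrema over an indicatrix are extrema over all regular vectors,
  and \<open>y\<^sub>1\<close> and \<open>y\<^sub>2\<close> may be varied independently: \<open>\<sigma> = f\<^bsup>l\<^esup> \<sigma>\<^sub>1 \<sigma>\<^sub>2\<close>. By Fubini the volume
  measure of the warped product is the product of the two given measures with density \<open>f\<^bsup>l\<^esup>\<close>,
  and \<open>f\<^bsup>l\<^esup> \<le> b\<^bsup>l\<^esup>\<close>. Fubini needs \<open>\<sigma>\<^sub>1\<close> and \<open>\<sigma>\<^sub>2\<close> to be measurable: as a supremum
  (infimum) of functions continuous in the base point they are lower (upper) semicontinuous.
\<close>


section \<open>Vectors and matrices indexed by a sum type\<close>

definition vec_left :: "real^('n::finite + 'l::finite) \<Rightarrow> real^'n" where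
  "vec_left z = (\<chi> i. z $ Inl i)"

definition vec_right :: "real^('n::finite + 'l::finite) \<Rightarrow> real^'l" where
  "vec_right z = (\<chi> i. z $ Inr i)"

lemma vec_join_nth [simp]: "vec_join x y $ Inl i = x $ i" "vec_join x y $ Inr j = y $ j"
  by (auto simp: vec_join_def)

lemma vec_left_join [simp]: "vec_left (vec_join x y) = x"
  and vec_right_join [simp]: "vec_right (vec_join x y) = y"
  by (auto simp: vec_left_def vec_right_def vec_eq_iff)

lemma vec_eq_sum_iff:
  fixes z w :: "'a^('n::finite + 'l::finite)"
  shows "z = w \<longleftrightarrow> (\<forall>i. z $ Inl i = w $ Inl i) \<and> (\<forall>j. z $ Inr j = w $ Inr j)"
  by (metis sum.exhaust vec_eq_iff)

lemma vec_join_left_right [simp]: "vec_join (vec_left z) (vec_right z) = z"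
  by (simp add: vec_eq_sum_iff) (simp add: vec_left_def vec_right_def)

lemma vec_join_eq_iff [simp]: "vec_join x y = vec_join x' y' \<longleftrightarrow> x = x' \<and> y = y'"
  by (metis vec_left_join vec_right_join)

lemma sum_UNIV_Plus:
  "(\<Sum>i\<in>UNIV. h i) = (\<Sum>i\<in>UNIV. h (Inl i)) + (\<Sum>j\<in>UNIV. h (Inr j))"
  for h :: "'n::finite + 'l::finite \<Rightarrow> 'a::comm_monoid_add"
  unfolding UNIV_Plus_UNIV[symmetric] by (subst sum.Plus) (simp_all add: comp_def)

lemma prod_UNIV_Plus:
  "(\<Prod>i\<in>UNIV. h i) = (\<Prod>i\<in>UNIV. h (Inl i)) * (\<Prod>j\<in>UNIV. h (Inr j))"
  for h :: "'n::finite + 'l::finite \<Rightarrow> 'a::comm_monoid_mult"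
  unfolding UNIV_Plus_UNIV[symmetric] by (subst prod.Plus) (simp_all add: comp_def)

lemma bounded_linear_vec_join: "bounded_linear (\<lambda>(x, y). vec_join x y)"
  by (simp add: linear_conv_bounded_linear[symmetric] linear_iff vec_eq_sum_iff split_beta)

lemma bounded_linear_vec_left: "bounded_linear vec_left"
  by (simp add: linear_conv_bounded_linear[symmetric] linear_iff vec_left_def vec_eq_iff)

lemma bounded_linear_vec_right: "bounded_linear vec_right"
  by (simp add: linear_conv_bounded_linear[symmetric] linear_iff vec_right_def vec_eq_iff)

lemma continuous_vec_join [continuous_intros]:
  "continuous_on S f \<Longrightarrow> continuous_on S g \<Longrightarrow> continuous_on S (\<lambda>x. vec_join (f x) (g x))"
  using bounded_linear.continuous_on[OF bounded_linear_vec_join continuous_on_Pair[of S f g]]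
  by simp

lemma open_vec_join_image:
  assumes "open U" "open V"
  shows "open ((\<lambda>(x, y). vec_join x y) ` (U \<times> V))"
proof -
  have "(\<lambda>(x, y). vec_join x y) ` (U \<times> V) = (vec_left -` U) \<inter> (vec_right -` V)"
    by (force simp: image_iff)
  then show ?thesis
    using assms by (simp add: open_Int open_vimage linear_continuous_on
      bounded_linear_vec_left bounded_linear_vec_right)
qed

section \<open>Lebesgue measure in coordinates indexed by a sum type\<close>

lemma emeasure_lborel_box_vec:
  fixes l u :: "real^'n::finite"
  assumes "\<And>i. l $ i \<le> u $ i"
  shows "emeasure lborel (box l u) = ennreal (\<Prod>i\<in>UNIV. u $ i - l $ i)"
proof -
  have "(\<Prod>b\<in>Basis. (u - l) \<bullet> b) = (\<Prod>i\<in>UNIV. u $ i - l $ i)"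
    by (simp add: Basis_vec_def cart_eq_inner_axis axis_eq_axis prod.UNION_disjoint inner_diff_left)
  with assms show ?thesis
    by (subst emeasure_lborel_box) (auto simp: Basis_vec_def inner_axis)
qed

lemma borel_measurable_vec_join [measurable]:
  "(\<lambda>(x, y). vec_join x y) \<in> borel_measurable borel"
  using linear_continuous_on[OF bounded_linear_vec_join] by (rule borel_measurable_continuous_onI)

text \<open>Lebesgue measure is determined by its values on boxes, and under \<open>vec_join\<close>
  a box pulls back to a product of two boxes. This later turns an iterated integral over two charts
  into one integral over the product chart.\<close>

lemma lborel_vec_join:
  "distr lborel borel (\<lambda>(x, y). vec_join x y) =
    (lborel :: (real^('n::finite + 'l::finite)) measure)"
proof (rule lborel_eqI[symmetric])
  fix l u :: "real^('n + 'l)"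
  assume lu: "\<And>b. b \<in> Basis \<Longrightarrow> l \<bullet> b \<le> u \<bullet> b"
  have le: "l $ i \<le> u $ i" for i
    using lu[of "axis i 1"] by (simp add: cart_eq_inner_axis axis_in_Basis_iff)
  have "(\<lambda>(x, y). vec_join x y) -` box l u =
      box (vec_left l) (vec_left u) \<times> box (vec_right l) (vec_right u)"
  proof (intro set_eqI, clarsimp simp: mem_box Basis_vec_def inner_axis)
    fix x :: "real^'n" and y :: "real^'l"
    show "(\<forall>i. l $ i < vec_join x y $ i \<and> vec_join x y $ i < u $ i) \<longleftrightarrow>
      (\<forall>i. vec_left l $ i < x $ i \<and> x $ i < vec_left u $ i) \<and>
      (\<forall>i. vec_right l $ i < y $ i \<and> y $ i < vec_right u $ i)"
      by (auto simp: vec_left_def vec_right_def split_sum_all)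
  qed
  then have "emeasure (distr lborel borel (\<lambda>(x, y). vec_join x y)) (box l u) =
      emeasure (lborel \<Otimes>\<^sub>M lborel)
        (box (vec_left l) (vec_left u) \<times> box (vec_right l) (vec_right u))"
    by (simp add: emeasure_distr lborel_prod)
  also have "\<dots> = emeasure lborel (box (vec_left l) (vec_left u)) *
      emeasure lborel (box (vec_right l) (vec_right u))"
    by (intro lborel.emeasure_pair_measure_Times) auto
  also have "\<dots> = ennreal (\<Prod>i\<in>UNIV. u $ i - l $ i)"
    using le by (simp add: emeasure_lborel_box_vec prod_UNIV_Plus vec_left_def vec_right_def
      ennreal_mult prod_nonneg)
  also have "(\<Prod>i\<in>UNIV. u $ i - l $ i) = (\<Prod>b\<in>Basis. (u - l) \<bullet> b)"
    by (simp add: Basis_vec_def cart_eq_inner_axis axis_eq_axis prod.UNION_disjoint inner_diff_left)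
  finally show "emeasure (distr lborel borel (\<lambda>(x, y). vec_join x y)) (box l u) =
      ennreal (\<Prod>b\<in>Basis. (u - l) \<bullet> b)" .
qed simp

section \<open>Determinants of block diagonal and of positive definite matrices\<close>

lemma det_extend_identity:
  fixes M :: "real^'m::finite^'m" and e :: "'n::finite \<Rightarrow> 'm"
  assumes e: "inj e" and M: "\<And>i j. i \<notin> range e \<Longrightarrow> M $ i $ j = (if i = j then 1 else 0)"
  shows "det M = det (\<chi> i j. M $ e i $ e j)"
proof -
  let ?P = "{p. p permutes (UNIV :: 'm set)}" and ?Q = "{p. p permutes range e}"
  let ?R = "{p. p permutes (UNIV :: 'n set)}"
  let ?t = "\<lambda>p. of_int (sign p) * (\<Prod>i\<in>UNIV. M $ i $ p i)"
  have bij: "bij_betw e UNIV (range e)"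
    using e by (simp add: bij_betw_def)
  \<comment> \<open>In the Leibniz sum, a permutation that moves some index outside
    \<open>range e\<close> picks an off-diagonal entry of an identity row, so its term vanishes. The
    remaining permutations are those of \<open>range e\<close>, and \<open>e\<close> conjugates them
    to permutations of the smaller index type.\<close>
  have "?t p = 0" if p: "p \<in> ?P - ?Q" for p
  proof -
    obtain i where "i \<notin> range e" "p i \<noteq> i"
      using p permutes_superset[of p UNIV "range e"] by auto
    then have "M $ i $ p i = 0"
      using M by auto
    then show ?thesis
      by (intro mult_eq_0_iff[THEN iffD2] disjI2 prod_zero) auto
  qed
  then have "det M = sum ?t ?Q"
    unfolding det_def
    by (intro sum.mono_neutral_right) (auto simp: finite_permutations intro: permutes_subset)
  also have "\<dots> = (\<Sum>q\<in>?R. ?t (map_permutation UNIV e q))"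
  proof (rule sum.reindex_bij_betw[symmetric])
    show "bij_betw (map_permutation UNIV e) ?R ?Q"
    proof (rule bij_betw_byWitness[where f' = "map_permutation (range e) (inv e)"])
      show "\<forall>q\<in>?R. map_permutation (range e) (inv e) (map_permutation UNIV e q) = q"
        using e bij by (auto intro!: map_permutation_compose_inv)
      show "\<forall>q\<in>?Q. map_permutation UNIV e (map_permutation (range e) (inv e) q) = q"
        using e bij by (auto intro!: map_permutation_compose_inv bij_betw_inv_into)
      show "map_permutation UNIV e ` ?R \<subseteq> ?Q"
        using bij by (auto intro: map_permutation_permutes)
      show "map_permutation (range e) (inv e) ` ?Q \<subseteq> ?R"
        using bij by (auto intro!: map_permutation_permutes bij_betw_inv_into)
    qed
  qed
  also have "\<dots> = (\<Sum>q\<in>?R. of_int (sign q) * (\<Prod>i\<in>UNIV. (\<chi> i j. M $ e i $ e j) $ i $ q i))"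
  proof (rule sum.cong[OF refl])
    fix q assume "q \<in> ?R"
    then have q: "q permutes UNIV"
      by simp
    have per: "map_permutation UNIV e q permutes range e"
      using bij q by (rule map_permutation_permutes)
    \<comment> \<open>Indices outside \<open>range e\<close> are fixed and contribute the diagonal
      entry 1.\<close>
    have "(\<Prod>i\<in>UNIV. M $ i $ map_permutation UNIV e q i) =
        (\<Prod>i\<in>range e. M $ i $ map_permutation UNIV e q i)"
      using per M by (intro prod.mono_neutral_right) (auto simp: permutes_not_in)
    also have "\<dots> = (\<Prod>i\<in>UNIV. M $ e i $ e (q i))"
      using e by (subst prod.reindex) (auto simp: map_permutation_apply)
    finally show "?t (map_permutation UNIV e q) =
        of_int (sign q) * (\<Prod>i\<in>UNIV. (\<chi> i j. M $ e i $ e j) $ i $ q i)"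
      using e q by (simp add: sign_map_permutation)
  qed
  also have "\<dots> = det (\<chi> i j. M $ e i $ e j)"
    by (simp add: det_def)
  finally show ?thesis .
qed

definition block_diag :: "real^'n^'n \<Rightarrow> real^'l^'l \<Rightarrow> real^('n::finite + 'l::finite)^('n + 'l)" where
  "block_diag A B = (\<chi> i j. case i of
      Inl i' \<Rightarrow> (case j of Inl j' \<Rightarrow> A $ i' $ j' | Inr _ \<Rightarrow> 0)
    | Inr i' \<Rightarrow> (case j of Inl _ \<Rightarrow> 0 | Inr j' \<Rightarrow> B $ i' $ j'))"

text \<open>Splitting the matrix into a product with one block replaced by the identity in each
  factor reduces the claim to \<open>det_extend_identity\<close>, once for each injection into the
  sum type.\<close>

lemma det_block_diag:
  fixes A :: "real^'n::finite^'n" and B :: "real^'l::finite^'l"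
  shows "det (block_diag A B) = det A * det B"
proof -
  have "block_diag A B = block_diag A (mat 1) ** block_diag (mat 1) B"
    by (auto simp: vec_eq_sum_iff matrix_matrix_mult_def sum_UNIV_Plus block_diag_def mat_def
      if_distrib if_distribR cong: if_cong)
  moreover have "det (block_diag A (mat 1 :: real^'l^'l)) = det A"
    by (subst det_extend_identity[where e = Inl])
      (auto simp: block_diag_def mat_def image_iff split: sum.split)
  moreover have "det (block_diag (mat 1 :: real^'n^'n) B) = det B"
    by (subst det_extend_identity[where e = Inr])
      (auto simp: block_diag_def mat_def image_iff split: sum.split)
  ultimately show ?thesis
    by (simp only: det_mul)
qed

text \<open>Every matrix on the segment from the identity to \<open>A\<close> has a positive
  quadratic form and is therefore invertible. By the intermediate value theorem the determinant,
  which starts at 1, cannot become nonpositive at the other end. No eigenvalues enter.\<close>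

lemma det_pos_of_positive_definite:
  fixes A :: "real^'n::finite^'n"
  assumes A: "\<And>w. w \<noteq> 0 \<Longrightarrow> 0 < w \<bullet> (A *v w)"
  shows "0 < det A"
proof (rule ccontr)
  let ?M = "\<lambda>t::real. (1 - t) *\<^sub>R mat 1 + t *\<^sub>R A"
  assume "\<not> 0 < det A"
  moreover have "continuous_on {0..1} (\<lambda>t. det (?M t))"
    unfolding det_def by (simp, intro continuous_intros)
  ultimately obtain t where t: "0 \<le> t" "t \<le> 1" "det (?M t) = 0"
    using IVT2'[of "\<lambda>t. det (?M t)" 1 0 0] by auto
  then obtain w where w: "w \<noteq> 0" "?M t *v w = 0"
    using det_nz_iff_inj[of "(*v) (?M t)"] linear_injective_0[of "(*v) (?M t)"]
    by auto
  have "w \<bullet> (?M t *v w) = (1 - t) * (w \<bullet> w) + t * (w \<bullet> (A *v w))"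
    by (simp add: matrix_vector_mult_add_rdistrib scaleR_matrix_vector_assoc[symmetric]
        inner_add_right)
  moreover have "0 < (1 - t) * (w \<bullet> w) + t * (w \<bullet> (A *v w))"
    using t(1,2) A[OF w(1)] w(1)
    by (cases "t = 1") (auto intro!: add_pos_nonneg)
  ultimately show False
    using w(2) by simp
qed


section \<open>Second derivatives and Minkowski norms\<close>

text \<open>The fundamental tensor stripped of charts: with \<open>h\<close> the square of a metric
  restricted to one tangent space, this is the matrix of the g_ij.\<close>

definition half_hessian :: "(real^'n::finite \<Rightarrow> real) \<Rightarrow> real^'n \<Rightarrow> real^'n^'n" where
  "half_hessian h y = (\<chi> i j. 1/2 * partial_deriv i (partial_deriv j h) y)"

lemma partial_derivI:
  "((\<lambda>t. h (y + t *\<^sub>R axis i 1)) has_field_derivative D) (at 0) \<Longrightarrow> partial_deriv i h y = D"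
  unfolding partial_deriv_def by (rule DERIV_imp_deriv)

text \<open>Identities between derivatives are available only away from the origin. A line through a
  nonzero point stays there for small parameters, which is enough to exchange functions under a
  derivative at 0.\<close>

lemma eventually_line_neq_0:
  fixes y v :: "'a::real_normed_vector"
  assumes "y \<noteq> 0"
  shows "\<forall>\<^sub>F t in nhds (0::real). y + t *\<^sub>R v \<noteq> 0"
proof -
  have "((\<lambda>t. y + t *\<^sub>R v) \<longlongrightarrow> y + 0 *\<^sub>R v) (nhds (0::real))"
    by (intro tendsto_add tendsto_const tendsto_scaleR filterlim_ident)
  then have "((\<lambda>t. y + t *\<^sub>R v) \<longlongrightarrow> y) (nhds (0::real))"
    by simp
  then show ?thesis
    using assms by (rule tendsto_imp_eventually_ne)
qed

text \<open>\<open>partial_deriv\<close> rests on \<open>deriv\<close>, which yields an arbitrary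
  number where no derivative exists; this predicate certifies that its values are genuine
  derivatives. The origin is left out because the square of a Finsler metric need not be smooth
  there.\<close>

definition has_partials :: "(real^'n::finite \<Rightarrow> real) \<Rightarrow> bool" where
  "has_partials h \<longleftrightarrow> (\<forall>y\<noteq>0. \<forall>i.
     ((\<lambda>t. h (y + t *\<^sub>R axis i 1)) has_field_derivative partial_deriv i h y) (at 0))"

lemma has_partialsD:
  "has_partials h \<Longrightarrow> y \<noteq> 0 \<Longrightarrow>
    ((\<lambda>t. h (y + t *\<^sub>R axis i 1)) has_field_derivative partial_deriv i h y) (at 0)"
  by (auto simp: has_partials_def)

text \<open>A shift by t after scaling is a shift by \<open>t / r\<close> before scaling, so the
  chain rule divides the scaling factor \<open>c\<close> by \<open>r\<close>.\<close>

lemma partial_deriv_homogeneous: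
  assumes h: "has_partials h" and hom: "\<And>z. z \<noteq> 0 \<Longrightarrow> h (r *\<^sub>R z) = c * h z"
    and r: "0 < r" and y: "y \<noteq> 0"
  shows "partial_deriv i h (r *\<^sub>R y) = c / r * partial_deriv i h y"
proof (rule partial_derivI)
  let ?g = "\<lambda>t. h (y + t *\<^sub>R axis i 1)"
  have ev: "\<forall>\<^sub>F t in nhds (0::real). r *\<^sub>R y + t *\<^sub>R axis i 1 \<noteq> 0"
    using r y by (intro eventually_line_neq_0) auto
  have eq: "h (r *\<^sub>R y + t *\<^sub>R axis i 1) = c * ?g (t / r)"
    if "r *\<^sub>R y + t *\<^sub>R axis i 1 \<noteq> 0" for t
  proof -
    have *: "r *\<^sub>R y + t *\<^sub>R axis i 1 = r *\<^sub>R (y + (t / r) *\<^sub>R axis i 1)"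
      using r by (simp add: scaleR_add_right)
    with that have "y + (t / r) *\<^sub>R axis i 1 \<noteq> 0"
      by (metis scaleR_zero_right)
    with hom * show ?thesis
      by simp
  qed
  have "((\<lambda>t. c * ?g (t / r)) has_field_derivative c * (partial_deriv i h y * (1 / r))) (at 0)"
    by (intro DERIV_cmult DERIV_chain2[of ?g])
      (use r has_partialsD[OF h y, of i] in \<open>auto intro!: derivative_eq_intros\<close>)
  then show "((\<lambda>t. h (r *\<^sub>R y + t *\<^sub>R axis i 1)) has_field_derivative
      c / r * partial_deriv i h y) (at 0)"
    by (subst DERIV_cong_ev[OF refl eventually_mono[OF ev eq] refl]) (auto simp: mult_ac)
qed

lemma vec_left_right_line [simp]:
  "vec_left (z + t *\<^sub>R axis (Inl i) 1) = vec_left z + t *\<^sub>R axis i 1"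
  "vec_right (z + t *\<^sub>R axis (Inl i) 1) = vec_right z"
  "vec_left (z + t *\<^sub>R axis (Inr j) 1) = vec_left z"
  "vec_right (z + t *\<^sub>R axis (Inr j) 1) = vec_right z + t *\<^sub>R axis j 1"
  by (auto simp: vec_left_def vec_right_def vec_eq_iff axis_def)

text \<open>A sum of functions of separate variables has no mixed second derivatives. The inner
  derivatives are known only where the relevant component is nonzero, so the outer ones are computed
  after a local replacement.\<close>

lemma half_hessian_block:
  fixes h1 :: "real^'n::finite \<Rightarrow> real" and h2 :: "real^'l::finite \<Rightarrow> real"
    and c :: real
  defines "H \<equiv> \<lambda>z. h1 (vec_left z) + c * h2 (vec_right z)"
  assumes h1: "has_partials h1" "\<And>j. has_partials (partial_deriv j h1)"
    and h2: "has_partials h2" "\<And>j. has_partials (partial_deriv j h2)"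
    and z: "vec_left z \<noteq> 0" "vec_right z \<noteq> 0"
  shows "half_hessian H z =
    block_diag (half_hessian h1 (vec_left z)) (c *\<^sub>R half_hessian h2 (vec_right z))"
proof -
  have left: "partial_deriv (Inl j) H w = partial_deriv j h1 (vec_left w)"
    if "vec_left w \<noteq> 0" for w j
    unfolding H_def
    using has_partialsD[OF h1(1) that, of j]
    by (intro partial_derivI) (auto intro!: derivative_eq_intros)
  have right: "partial_deriv (Inr j) H w = c * partial_deriv j h2 (vec_right w)"
    if "vec_right w \<noteq> 0" for w j
    unfolding H_def
    using has_partialsD[OF h2(1) that, of j]
    by (intro partial_derivI) (auto intro!: derivative_eq_intros)
  have ll: "partial_deriv (Inl i) (partial_deriv (Inl j) H) z =
      partial_deriv i (partial_deriv j h1) (vec_left z)" for i j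
  proof (rule partial_derivI)
    show "((\<lambda>t. partial_deriv (Inl j) H (z + t *\<^sub>R axis (Inl i) 1)) has_field_derivative
        partial_deriv i (partial_deriv j h1) (vec_left z)) (at 0)"
      using eventually_mono[OF eventually_line_neq_0[OF z(1), of "axis i 1"]]
        has_partialsD[OF h1(2) z(1), of j i]
      by (subst DERIV_cong_ev[OF refl _ refl]) (auto simp: left)
  qed
  have rr: "partial_deriv (Inr i) (partial_deriv (Inr j) H) z =
      c * partial_deriv i (partial_deriv j h2) (vec_right z)" for i j
  proof (rule partial_derivI)
    show "((\<lambda>t. partial_deriv (Inr j) H (z + t *\<^sub>R axis (Inr i) 1)) has_field_derivative
        c * partial_deriv i (partial_deriv j h2) (vec_right z)) (at 0)"
      using eventually_mono[OF eventually_line_neq_0[OF z(2), of "axis i 1"]]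
        DERIV_cmult[OF has_partialsD[OF h2(2) z(2), of j i]]
      by (subst DERIV_cong_ev[OF refl _ refl]) (auto simp: right)
  qed
  \<comment> \<open>Along this line the right component does not move, so the inner derivative is
    constant.\<close>
  have "partial_deriv (Inl i) (partial_deriv (Inr j) H) z = 0" for i j
    using z by (intro partial_derivI) (simp add: right)
  moreover have "partial_deriv (Inr i) (partial_deriv (Inl j) H) z = 0" for i j
    using z by (intro partial_derivI) (simp add: left)
  ultimately show ?thesis
    by (simp add: vec_eq_sum_iff half_hessian_def block_diag_def ll rr)
qed

text \<open>A Finsler metric on a single tangent space, read in coordinates. Smoothness is reduced
  to two partial derivatives of the square and a continuous Hessian off the origin; homogeneity is
  for positive factors, so the norm may be irreversible.\<close>

locale minkowski_norm =
  fixes \<phi> :: "real^'n::finite \<Rightarrow> real"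
  assumes homogeneous: "0 < r \<Longrightarrow> \<phi> (r *\<^sub>R y) = r * \<phi> y"
    and pos: "y \<noteq> 0 \<Longrightarrow> 0 < \<phi> y"
    and partials: "has_partials (\<lambda>z. (\<phi> z)\<^sup>2)"
    and partials2: "has_partials (partial_deriv j (\<lambda>z. (\<phi> z)\<^sup>2))"
    and continuous_hessian: "continuous_on (UNIV - {0}) (half_hessian (\<lambda>z. (\<phi> z)\<^sup>2))"
    and positive_definite:
      "y \<noteq> 0 \<Longrightarrow> w \<noteq> 0 \<Longrightarrow> 0 < w \<bullet> (half_hessian (\<lambda>z. (\<phi> z)\<^sup>2) y *v w)"
begin

abbreviation vol_density :: "real^'n \<Rightarrow> real" where
  "vol_density y \<equiv> sqrt (det (half_hessian (\<lambda>z. (\<phi> z)\<^sup>2) y))"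

lemma density_pos: "y \<noteq> 0 \<Longrightarrow> 0 < vol_density y"
  by (simp add: det_pos_of_positive_definite positive_definite)

text \<open>The square is homogeneous of degree 2, and each differentiation lowers the degree by
  one: the factors are \<open>r\<^sup>2\<close>, then \<open>r\<close>, then 1.\<close>

lemma hessian_homogeneous:
  assumes "0 < r" "y \<noteq> 0"
  shows "half_hessian (\<lambda>z. (\<phi> z)\<^sup>2) (r *\<^sub>R y) = half_hessian (\<lambda>z. (\<phi> z)\<^sup>2) y"
proof -
  have "partial_deriv j (\<lambda>z. (\<phi> z)\<^sup>2) (r *\<^sub>R z) = r * partial_deriv j (\<lambda>z. (\<phi> z)\<^sup>2) z"
    if "z \<noteq> 0" for z j
    using partial_deriv_homogeneous[OF partials, of r "r\<^sup>2" z j] assms that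
    by (simp add: homogeneous power_mult_distrib power2_eq_square[of r])
  then have "partial_deriv i (partial_deriv j (\<lambda>z. (\<phi> z)\<^sup>2)) (r *\<^sub>R y) =
      partial_deriv i (partial_deriv j (\<lambda>z. (\<phi> z)\<^sup>2)) y" for i j
    using assms by (subst partial_deriv_homogeneous[where c = r]) (auto simp: partials2)
  then show ?thesis
    by (simp add: half_hessian_def)
qed

text \<open>Dividing \<open>y\<close> by \<open>\<phi> y\<close> reaches the indicatrix without
  changing the Hessian. Dropping the constraint \<open>\<phi> y = 1\<close> is what later lets the
  two components of a product vector vary independently.\<close>

lemma density_unit: "vol_density ` {y. y \<noteq> 0 \<and> \<phi> y = 1} = vol_density ` (- {0})"
proof -
  have "vol_density y \<in> vol_density ` {y. y \<noteq> 0 \<and> \<phi> y = 1}" if "y \<noteq> 0" for y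
    using that pos[of y]
    by (intro image_eqI[of _ _ "(1 / \<phi> y) *\<^sub>R y"]) (auto simp: hessian_homogeneous homogeneous)
  then show ?thesis
    by blast
qed

text \<open>The same rescaling, now onto the Euclidean sphere, whose compactness is at hand and
  carries the existence of extrema.\<close>

lemma density_sphere: "vol_density ` sphere 0 1 = vol_density ` (- {0})"
proof -
  have "vol_density y \<in> vol_density ` sphere 0 1" if "y \<noteq> 0" for y
    using that
    by (intro image_eqI[of _ _ "(1 / norm y) *\<^sub>R y"]) (auto simp: hessian_homogeneous)
  moreover have "sphere 0 1 \<subseteq> - {0 :: real^'n}"
    by auto
  ultimately show ?thesis
    by blast
qed

text \<open>Ensures that both extrema are attained, so that \<open>GREATEST\<close> and
  \<open>LEAST\<close> in the definitions of the extremal densities denote actual values.\<close>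

lemma compact_densities: "compact (vol_density ` (- {0}))"
proof -
  have "continuous_on (sphere 0 1) vol_density"
    unfolding det_def
    by (intro continuous_intros continuous_on_subset[OF continuous_hessian]) auto
  then show ?thesis
    unfolding density_sphere[symmetric] by (intro compact_continuous_image) auto
qed

lemma densities_nonempty: "vol_density ` (- {0}) \<noteq> {}"
  by (simp add: density_sphere[symmetric])

end

text \<open>The Hessian is block diagonal, so the density factors. The condition
  \<open>\<Phi> z = 1\<close> couples the two components, but scaling both by one common factor
  moves any pair of nonzero vectors onto the indicatrix and preserves both factors; hence a full
  product of value sets appears.\<close>

lemma warped_density_image:
  fixes \<phi>1 :: "real^'n::finite \<Rightarrow> real" and \<phi>2 :: "real^'l::finite \<Rightarrow> real"
  assumes "minkowski_norm \<phi>1" "minkowski_norm \<phi>2" "0 < k"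
  defines "\<Phi> \<equiv> \<lambda>z. sqrt ((\<phi>1 (vec_left z))\<^sup>2 + k\<^sup>2 * (\<phi>2 (vec_right z))\<^sup>2)"
  shows "(\<lambda>z. sqrt (det (half_hessian (\<lambda>z. (\<Phi> z)\<^sup>2) z))) `
      {z. vec_left z \<noteq> 0 \<and> vec_right z \<noteq> 0 \<and> \<Phi> z = 1} =
    (\<lambda>(s, t). k ^ CARD('l) * s * t) `
      (minkowski_norm.vol_density \<phi>1 ` (- {0}) \<times> minkowski_norm.vol_density \<phi>2 ` (- {0}))"
proof -
  interpret n1: minkowski_norm \<phi>1 by fact
  interpret n2: minkowski_norm \<phi>2 by fact
  have dens: "sqrt (det (half_hessian (\<lambda>z. (\<Phi> z)\<^sup>2) z)) =
      k ^ CARD('l) * n1.vol_density (vec_left z) * n2.vol_density (vec_right z)"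
    if "vec_left z \<noteq> 0" "vec_right z \<noteq> 0" for z
  proof -
    have sq: "(\<lambda>z. (\<Phi> z)\<^sup>2) = (\<lambda>z. (\<phi>1 (vec_left z))\<^sup>2 + k\<^sup>2 * (\<phi>2 (vec_right z))\<^sup>2)"
      by (simp add: \<Phi>_def)
    \<comment> \<open>Each of the \<open>CARD('l)\<close> rows contributes a factor
      \<open>k\<^sup>2\<close>; the square root below leaves \<open>k ^ CARD('l)\<close>.\<close>
    have "det (k\<^sup>2 *\<^sub>R half_hessian (\<lambda>z. (\<phi>2 z)\<^sup>2) (vec_right z)) =
        (k ^ CARD('l))\<^sup>2 * det (half_hessian (\<lambda>z. (\<phi>2 z)\<^sup>2) (vec_right z))"
      using det_rows_mul[of "\<lambda>_. k\<^sup>2" "\<lambda>i. half_hessian (\<lambda>z. (\<phi>2 z)\<^sup>2) (vec_right z) $ i"]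
      by (simp add: scalar_mult_eq_scaleR scaleR_vec_def vec_lambda_eta power_mult[symmetric] mult.commute)
    then show ?thesis
      using assms(3) half_hessian_block[OF n1.partials n1.partials2 n2.partials n2.partials2 that,
          where c = "k\<^sup>2"]
      by (simp add: sq det_block_diag real_sqrt_mult)
  qed
  let ?L = "(\<lambda>z. sqrt (det (half_hessian (\<lambda>z. (\<Phi> z)\<^sup>2) z))) `
      {z. vec_left z \<noteq> 0 \<and> vec_right z \<noteq> 0 \<and> \<Phi> z = 1}"
  let ?R = "(\<lambda>(s, t). k ^ CARD('l) * s * t) ` (n1.vol_density ` (- {0}) \<times> n2.vol_density ` (- {0}))"
  have "k ^ CARD('l) * n1.vol_density x * n2.vol_density y \<in> ?L"
    if xy: "x \<noteq> 0" "y \<noteq> 0" for x y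
  proof -
    \<comment> \<open>The common factor that puts the joined vector on the indicatrix.\<close>
    define r where "r = 1 / \<Phi> (vec_join x y)"
    have "0 < \<Phi> (vec_join x y)"
      using n1.pos[OF xy(1)] by (simp add: \<Phi>_def add_pos_nonneg)
    then have r: "0 < r"
      by (simp add: r_def)
    have "\<Phi> (vec_join (r *\<^sub>R x) (r *\<^sub>R y)) = sqrt (r\<^sup>2 * ((\<phi>1 x)\<^sup>2 + k\<^sup>2 * (\<phi>2 y)\<^sup>2))"
      using r by (simp add: \<Phi>_def n1.homogeneous n2.homogeneous power_mult_distrib algebra_simps)
    also have "\<dots> = r * \<Phi> (vec_join x y)"
      using r by (simp add: \<Phi>_def real_sqrt_mult)
    also have "\<dots> = 1"
      using r by (simp add: r_def)
    finally show ?thesis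
      using xy r
      by (intro image_eqI[of _ _ "vec_join (r *\<^sub>R x) (r *\<^sub>R y)"])
        (simp_all add: dens n1.hessian_homogeneous n2.hessian_homogeneous)
  qed
  moreover have "sqrt (det (half_hessian (\<lambda>z. (\<Phi> z)\<^sup>2) z)) \<in> ?R"
    if "vec_left z \<noteq> 0" "vec_right z \<noteq> 0" for z
    using that
    by (auto simp: dens intro!: image_eqI[of _ _ "(n1.vol_density (vec_left z), n2.vol_density (vec_right z))"])
  ultimately show ?thesis
    by auto
qed


section \<open>Charts of products\<close>

lemma prod_chart_simps [simp]:
  "chart_dom (prod_chart c d) = chart_dom c \<times> chart_dom d"
  "chart_map (prod_chart c d) = (\<lambda>(p, q). vec_join (chart_map c p) (chart_map d q))"
  by (simp_all add: prod_chart_def)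

lemma is_chart_inverse:
  assumes "is_chart c"
  shows "p \<in> chart_dom c \<Longrightarrow> chart_inv c (chart_map c p) = p"
    and "x \<in> chart_image c \<Longrightarrow> chart_map c (chart_inv c x) = x"
    and "x \<in> chart_image c \<Longrightarrow> chart_inv c x \<in> chart_dom c"
  using assms unfolding is_chart_def homeomorphism_def by auto

lemma is_chart_continuous:
  assumes "is_chart c"
  shows "continuous_on (chart_dom c) (chart_map c)" "continuous_on (chart_image c) (chart_inv c)"
  using assms unfolding is_chart_def homeomorphism_def by auto

lemma is_chart_open:
  "is_chart c \<Longrightarrow> open (chart_dom c)" "is_chart c \<Longrightarrow> open (chart_image c)"
  unfolding is_chart_def by auto

lemma chart_map_image_eq:
  assumes "is_chart c" "B \<subseteq> chart_dom c"
  shows "chart_map c ` B = chart_image c \<inter> chart_inv c -` B"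
  using assms(2) by (auto simp: is_chart_inverse[OF assms(1)])

lemma open_chart_map_image:
  assumes "is_chart c" "open U" "U \<subseteq> chart_dom c"
  shows "open (chart_map c ` U)"
  unfolding chart_map_image_eq[OF assms(1,3)]
  by (intro continuous_open_preimage is_chart_continuous is_chart_open assms)

text \<open>The part of \<open>smooth_atlas\<close> that passes to products without a chain rule for
  \<open>Ck_on\<close>.\<close>

definition differentiable_atlas ::
    "('m::topological_space, 'n::finite) chart set \<Rightarrow> bool" where
  "differentiable_atlas A \<longleftrightarrow> (\<forall>c\<in>A. is_chart c) \<and> (\<Union>c\<in>A. chart_dom c) = UNIV \<and>
     (\<forall>c\<in>A. \<forall>d\<in>A. \<forall>p\<in>chart_dom c \<inter> chart_dom d.
        (chart_map d \<circ> chart_inv c) differentiable (at (chart_map c p)))"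

lemma smooth_on_differentiable: "smooth_on S h \<Longrightarrow> x \<in> S \<Longrightarrow> h differentiable (at x)"
  unfolding smooth_on_def by (drule spec[of _ "Suc 0"]) simp

lemma smooth_atlas_differentiable: "smooth_atlas A \<Longrightarrow> differentiable_atlas A"
  unfolding smooth_atlas_def differentiable_atlas_def
  by (intro conjI ballI smooth_on_differentiable) (auto intro: imageI)

section \<open>Derivatives and tangent vectors in the charts of one atlas\<close>

context
  fixes A :: "('m::topological_space, 'n::finite) chart set"
  assumes A: "differentiable_atlas A"
begin

lemma atlas_chart: "c \<in> A \<Longrightarrow> is_chart c"
  using A by (simp add: differentiable_atlas_def)

lemma atlas_cover: "\<exists>c\<in>A. p \<in> chart_dom c"
  using A unfolding differentiable_atlas_def by auto

lemma atlas_transition: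
  assumes "c \<in> A" "d \<in> A" "p \<in> chart_dom c" "p \<in> chart_dom d"
  shows "((chart_map d \<circ> chart_inv c) has_derivative
    frechet_derivative (chart_map d \<circ> chart_inv c) (at (chart_map c p))) (at (chart_map c p))"
  using A assms unfolding differentiable_atlas_def frechet_derivative_works[symmetric] by auto

text \<open>The chain rule through the transition map. The composite agrees with
  \<open>h \<circ> chart_inv c\<close> only on the image of the overlap, but that set is open, which
  suffices for a derivative at a point.\<close>

lemma has_derivative_change_chart:
  assumes c: "c \<in> A" "p \<in> chart_dom c" and d: "d \<in> A" "p \<in> chart_dom d"
    and h: "((h \<circ> chart_inv d) has_derivative h') (at (chart_map d p))"
  shows "((h \<circ> chart_inv c) has_derivative
    h' \<circ> frechet_derivative (chart_map d \<circ> chart_inv c) (at (chart_map c p))) (at (chart_map c p))"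
proof (rule has_derivative_transform_within_open)
  have [simp]: "is_chart c" "is_chart d"
    using c d by (auto intro: atlas_chart)
  show "open (chart_map c ` (chart_dom c \<inter> chart_dom d))"
    by (intro open_chart_map_image) (auto simp: is_chart_open)
  show "chart_map c p \<in> chart_map c ` (chart_dom c \<inter> chart_dom d)"
    using c d by auto
  show "(((h \<circ> chart_inv d) \<circ> (chart_map d \<circ> chart_inv c)) has_derivative
      h' \<circ> frechet_derivative (chart_map d \<circ> chart_inv c) (at (chart_map c p))) (at (chart_map c p))"
    using atlas_transition[OF c(1) d(1) c(2) d(2)] h c d
    by (intro diff_chain_at) (auto simp: is_chart_inverse)
  show "((h \<circ> chart_inv d) \<circ> (chart_map d \<circ> chart_inv c)) x = (h \<circ> chart_inv c) x"
    if "x \<in> chart_map c ` (chart_dom c \<inter> chart_dom d)" for x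
    using that by (auto simp: is_chart_inverse)
qed

text \<open>The transformation law is the cocycle identity for derivatives of transition maps,
  obtained from the chain rule and uniqueness of derivatives.\<close>

lemma coord_vector_tangent:
  assumes "c \<in> A" "p \<in> chart_dom c"
  shows "coord_vector A c p y \<in> tangent_space A p"
proof -
  have *: "frechet_derivative (chart_map e \<circ> chart_inv c) (at (chart_map c p)) y =
      frechet_derivative (chart_map e \<circ> chart_inv d) (at (chart_map d p))
        (frechet_derivative (chart_map d \<circ> chart_inv c) (at (chart_map c p)) y)"
    if "d \<in> A" "p \<in> chart_dom d" "e \<in> A" "p \<in> chart_dom e" for d e
    using frechet_derivative_at[OF has_derivative_change_chart[OF assms that(1,2)
          atlas_transition[OF that(1,3,2,4)]]]
    by (simp only: comp_apply fun_eq_iff)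
  show ?thesis
    unfolding tangent_space_def
    by (auto simp: coord_vector_def intro: *)
qed

lemma coord_vector_self:
  assumes c: "c \<in> A" "p \<in> chart_dom c"
  shows "coord_vector A c p y c = y"
proof -
  have "((chart_map c \<circ> chart_inv c) has_derivative (\<lambda>x. x)) (at (chart_map c p))"
  proof (rule has_derivative_transform_within_open[OF has_derivative_ident])
    show "open (chart_image c)" "chart_map c p \<in> chart_image c"
      using c atlas_chart[OF c(1)] by (auto simp: is_chart_open)
    show "x = (chart_map c \<circ> chart_inv c) x" if "x \<in> chart_image c" for x
      using is_chart_inverse(2)[OF atlas_chart[OF c(1)] that] by simp
  qed
  then have "frechet_derivative (chart_map c \<circ> chart_inv c) (at (chart_map c p)) = (\<lambda>x. x)"
    by (rule frechet_derivative_at[symmetric])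
  then show ?thesis
    using c by (simp add: coord_vector_def)
qed

text \<open>With \<open>coord_vector_self\<close> this makes the coordinates in one chart a
  bijection between the tangent space and \<open>real^'n\<close>. The convention that tangent
  vectors vanish at charts away from \<open>p\<close> settles the remaining charts.\<close>

lemma coord_vector_coordinates:
  assumes "c \<in> A" "p \<in> chart_dom c" "v \<in> tangent_space A p"
  shows "coord_vector A c p (v c) = v"
proof
  fix d
  have "v d = frechet_derivative (chart_map d \<circ> chart_inv c) (at (chart_map c p)) (v c)"
    if "d \<in> A" "p \<in> chart_dom d"
    using assms that unfolding tangent_space_def by blast
  moreover have "v d = 0" if "\<not> (d \<in> A \<and> p \<in> chart_dom d)"
    using assms(3) that unfolding tangent_space_def by blast
  ultimately show "coord_vector A c p (v c) d = v d"
    unfolding coord_vector_def by presburger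
qed

lemma coord_vector_scaleR:
  assumes "c \<in> A" "p \<in> chart_dom c"
  shows "coord_vector A c p (r *\<^sub>R y) = (\<lambda>d. r *\<^sub>R coord_vector A c p y d)"
proof
  fix d
  show "coord_vector A c p (r *\<^sub>R y) d = r *\<^sub>R coord_vector A c p y d"
    using linear_scale[OF has_derivative_linear[OF atlas_transition[OF assms(1) _ assms(2)]]]
    by (simp add: coord_vector_def)
qed

lemma coord_vector_0_iff:
  assumes "c \<in> A" "p \<in> chart_dom c"
  shows "coord_vector A c p y = (\<lambda>d. 0) \<longleftrightarrow> y = 0"
proof
  assume "y = 0"
  then show "coord_vector A c p y = (\<lambda>d. 0)"
    using coord_vector_scaleR[OF assms, of 0 y] by simp
qed (use coord_vector_self[OF assms, of y] in simp)

end

section \<open>Product charts and their inverses\<close>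

lemma chart_image_prod: "chart_image (prod_chart c d) =
    (\<lambda>(x, y). vec_join x y) ` (chart_image c \<times> chart_image d)"
  by (force simp: image_iff)

lemma chart_inv_prod:
  assumes c: "is_chart c" and d: "is_chart d" and x: "x \<in> chart_image c" and y: "y \<in> chart_image d"
  shows "chart_inv (prod_chart c d) (vec_join x y) = (chart_inv c x, chart_inv d y)"
proof -
  have "inj_on (chart_map (prod_chart c d)) (chart_dom (prod_chart c d))"
    using is_chart_inverse(1)[OF c] is_chart_inverse(1)[OF d]
    by (intro inj_onI) (clarsimp, metis)
  moreover have "vec_join x y = chart_map (prod_chart c d) (chart_inv c x, chart_inv d y)"
    using is_chart_inverse[OF c] is_chart_inverse[OF d] x y by simp
  ultimately show ?thesis
    using is_chart_inverse(3)[OF c x] is_chart_inverse(3)[OF d y]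
    unfolding chart_inv_def[of "prod_chart c d"] by (metis inv_into_f_f mem_Sigma_iff prod_chart_simps(1))
qed

lemma is_chart_prod:
  assumes c: "is_chart c" and d: "is_chart d"
  shows "is_chart (prod_chart c d)"
  unfolding is_chart_def
proof (intro conjI homeomorphismI)
  show "open (chart_dom (prod_chart c d))"
    using c d by (simp add: is_chart_open open_Times)
  show "open (chart_image (prod_chart c d))"
    using c d unfolding chart_image_prod by (intro open_vec_join_image) (auto simp: is_chart_open)
  have "continuous_on (chart_dom c \<times> chart_dom d)
      (\<lambda>x. vec_join (chart_map c (fst x)) (chart_map d (snd x)))"
    by (intro continuous_intros continuous_on_compose2[OF is_chart_continuous(1)[OF c]]
        continuous_on_compose2[OF is_chart_continuous(1)[OF d]]) auto
  then show "continuous_on (chart_dom (prod_chart c d)) (chart_map (prod_chart c d))"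
    by (simp add: split_beta)
  have "continuous_on (chart_image (prod_chart c d))
      (\<lambda>z. (chart_inv c (vec_left z), chart_inv d (vec_right z)))"
    unfolding chart_image_prod
    by (intro continuous_on_Pair continuous_on_compose2[OF is_chart_continuous(2)[OF c]]
        continuous_on_compose2[OF is_chart_continuous(2)[OF d]] linear_continuous_on
        bounded_linear_vec_left bounded_linear_vec_right) auto
  then show "continuous_on (chart_image (prod_chart c d)) (chart_inv (prod_chart c d))"
    unfolding chart_image_prod
    by (rule continuous_on_eq) (auto simp: chart_inv_prod c d)
  show "chart_inv (prod_chart c d) ` chart_image (prod_chart c d) \<subseteq> chart_dom (prod_chart c d)"
    unfolding chart_image_prod by (auto simp: chart_inv_prod is_chart_inverse c d)
  show "chart_inv (prod_chart c d) (chart_map (prod_chart c d) x) = x"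
    if "x \<in> chart_dom (prod_chart c d)" for x
    using that by (auto simp: chart_inv_prod is_chart_inverse c d)
  show "chart_map (prod_chart c d) (chart_inv (prod_chart c d) z) = z"
    if "z \<in> chart_image (prod_chart c d)" for z
    using that unfolding chart_image_prod by (auto simp: chart_inv_prod is_chart_inverse c d)
qed simp

section \<open>The product atlas and the differentials of the two projections\<close>

context
  fixes A1 :: "('m::topological_space, 'n::finite) chart set"
    and A2 :: "('k::topological_space, 'l::finite) chart set"
  assumes A1: "differentiable_atlas A1" and A2: "differentiable_atlas A2"
begin

text \<open>In product coordinates the first projection is a transition map of the base after the
  linear map \<open>vec_left\<close>. This serves both the differentiability of product transitions
  and the computation of \<open>dproj1\<close>.\<close>

lemma has_derivative_fst_prod_chart:
  assumes c: "c \<in> A1" "p \<in> chart_dom c" and d: "d \<in> A2" "q \<in> chart_dom d"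
    and e: "e \<in> A1" "p \<in> chart_dom e"
  shows "((chart_map e \<circ> fst \<circ> chart_inv (prod_chart c d)) has_derivative
    frechet_derivative (chart_map e \<circ> chart_inv c) (at (chart_map c p)) \<circ> vec_left)
    (at (chart_map (prod_chart c d) (p, q)))"
proof (rule has_derivative_transform_within_open)
  have [simp]: "is_chart c" "is_chart d"
    using c d A1 A2 by (auto intro: atlas_chart)
  show "open (chart_image (prod_chart c d))"
    by (intro is_chart_open is_chart_prod) auto
  show "chart_map (prod_chart c d) (p, q) \<in> chart_image (prod_chart c d)"
    using c d by auto
  show "((chart_map e \<circ> chart_inv c) \<circ> vec_left has_derivative
    frechet_derivative (chart_map e \<circ> chart_inv c) (at (chart_map c p)) \<circ> vec_left)
    (at (chart_map (prod_chart c d) (p, q)))"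
    using atlas_transition[OF A1 c(1) e(1) c(2) e(2)]
    by (intro diff_chain_at bounded_linear_imp_has_derivative bounded_linear_vec_left) simp
  show "((chart_map e \<circ> chart_inv c) \<circ> vec_left) z =
      (chart_map e \<circ> fst \<circ> chart_inv (prod_chart c d)) z"
    if "z \<in> chart_image (prod_chart c d)" for z
    using that by (auto simp: chart_inv_prod)
qed

lemma has_derivative_snd_prod_chart:
  assumes c: "c \<in> A1" "p \<in> chart_dom c" and d: "d \<in> A2" "q \<in> chart_dom d"
    and e: "e \<in> A2" "q \<in> chart_dom e"
  shows "((chart_map e \<circ> snd \<circ> chart_inv (prod_chart c d)) has_derivative
    frechet_derivative (chart_map e \<circ> chart_inv d) (at (chart_map d q)) \<circ> vec_right)
    (at (chart_map (prod_chart c d) (p, q)))"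
proof (rule has_derivative_transform_within_open)
  have [simp]: "is_chart c" "is_chart d"
    using c d A1 A2 by (auto intro: atlas_chart)
  show "open (chart_image (prod_chart c d))"
    by (intro is_chart_open is_chart_prod) auto
  show "chart_map (prod_chart c d) (p, q) \<in> chart_image (prod_chart c d)"
    using c d by auto
  show "((chart_map e \<circ> chart_inv d) \<circ> vec_right has_derivative
    frechet_derivative (chart_map e \<circ> chart_inv d) (at (chart_map d q)) \<circ> vec_right)
    (at (chart_map (prod_chart c d) (p, q)))"
    using atlas_transition[OF A2 d(1) e(1) d(2) e(2)]
    by (intro diff_chain_at bounded_linear_imp_has_derivative bounded_linear_vec_right) simp
  show "((chart_map e \<circ> chart_inv d) \<circ> vec_right) z =
      (chart_map e \<circ> snd \<circ> chart_inv (prod_chart c d)) z"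
    if "z \<in> chart_image (prod_chart c d)" for z
    using that by (auto simp: chart_inv_prod)
qed

text \<open>A transition between product charts joins its two components, each of which is a
  projection read in a product chart and so has a known derivative.\<close>

lemma differentiable_atlas_prod: "differentiable_atlas (prod_atlas A1 A2)"
  unfolding differentiable_atlas_def
proof (intro conjI ballI)
  show "is_chart C" if "C \<in> prod_atlas A1 A2" for C
    using that by (auto simp: prod_atlas_def is_chart_prod atlas_chart[OF A1] atlas_chart[OF A2])
  have "\<exists>C\<in>prod_atlas A1 A2. (p, q) \<in> chart_dom C" for p q
    using atlas_cover[OF A1, of p] atlas_cover[OF A2, of q]
    by (force simp: prod_atlas_def)
  then show "(\<Union>C\<in>prod_atlas A1 A2. chart_dom C) = UNIV"
    by auto
  fix C D pq assume "C \<in> prod_atlas A1 A2" "D \<in> prod_atlas A1 A2" "pq \<in> chart_dom C \<inter> chart_dom D"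
  then obtain c d c' d' p q where *: "C = prod_chart c d" "D = prod_chart c' d'" "pq = (p, q)"
      "c \<in> A1" "c' \<in> A1" "d \<in> A2" "d' \<in> A2"
      "p \<in> chart_dom c" "p \<in> chart_dom c'" "q \<in> chart_dom d" "q \<in> chart_dom d'"
    by (auto simp: prod_atlas_def)
  have "chart_map D \<circ> chart_inv C = (\<lambda>(x, y). vec_join x y) \<circ>
      (\<lambda>z. ((chart_map c' \<circ> fst \<circ> chart_inv C) z, (chart_map d' \<circ> snd \<circ> chart_inv C) z))"
    using * by (simp add: fun_eq_iff split_beta)
  moreover have "((\<lambda>(x, y). vec_join x y) \<circ>
      (\<lambda>z. ((chart_map c' \<circ> fst \<circ> chart_inv C) z, (chart_map d' \<circ> snd \<circ> chart_inv C) z)))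
      differentiable at (chart_map C pq)"
    unfolding differentiable_def *(1,3)
    by (rule exI, rule diff_chain_at, rule has_derivative_Pair,
        rule has_derivative_fst_prod_chart[OF *(4,8,6,10,5,9)],
        rule has_derivative_snd_prod_chart[OF *(4,8,6,10,7,11)],
        rule bounded_linear_imp_has_derivative[OF bounded_linear_vec_join])
  ultimately show "chart_map D \<circ> chart_inv C differentiable at (chart_map C pq)"
    by simp
qed

text \<open>\<open>differential\<close> works in an arbitrarily selected chart \<open>D\<close>, in
  general not the given product chart. Passing to \<open>D\<close> by the transition and projecting
  there has the same derivative as projecting directly, by the chain rule and uniqueness of
  derivatives.\<close>

lemma dproj1_coord_vector:
  assumes c: "c \<in> A1" "p \<in> chart_dom c" and d: "d \<in> A2" "q \<in> chart_dom d"
  shows "dproj1 A1 A2 (p, q) (coord_vector (prod_atlas A1 A2) (prod_chart c d) (p, q) z) =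
    coord_vector A1 c p (vec_left z)"
proof -
  let ?A = "prod_atlas A1 A2" and ?C = "prod_chart c d"
  define D where "D = (SOME C. C \<in> ?A \<and> (p, q) \<in> chart_dom C)"
  have D: "D \<in> ?A" "(p, q) \<in> chart_dom D"
    using someI_ex[of "\<lambda>C. C \<in> ?A \<and> (p, q) \<in> chart_dom C"]
      atlas_cover[OF differentiable_atlas_prod, of "(p, q)"] by (auto simp: D_def)
  then obtain c' d' where c': "D = prod_chart c' d'" "c' \<in> A1" "d' \<in> A2" "p \<in> chart_dom c'" "q \<in> chart_dom d'"
    by (auto simp: prod_atlas_def)
  have C: "?C \<in> ?A" "(p, q) \<in> chart_dom ?C"
    using c d by (auto simp: prod_atlas_def)
  have "frechet_derivative (chart_map e \<circ> fst \<circ> chart_inv D) (at (chart_map D (p, q)))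
      (frechet_derivative (chart_map D \<circ> chart_inv ?C) (at (chart_map ?C (p, q))) z) =
    frechet_derivative (chart_map e \<circ> chart_inv c) (at (chart_map c p)) (vec_left z)"
    if e: "e \<in> A1" "p \<in> chart_dom e" for e
  proof -
    have dD: "(chart_map e \<circ> fst \<circ> chart_inv D) differentiable at (chart_map D (p, q))"
      using has_derivative_fst_prod_chart[OF c'(2,4,3,5) e] unfolding c'(1) differentiable_def by blast
    show ?thesis
      using has_derivative_unique[OF has_derivative_fst_prod_chart[OF c d e]
        has_derivative_change_chart[OF differentiable_atlas_prod C D dD[unfolded frechet_derivative_works]]]
      by (simp add: fun_eq_iff)
  qed
  then show ?thesis
    using D by (auto simp: dproj1_def differential_def Let_def D_def[symmetric] coord_vector_def fun_eq_iff)
qed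

lemma dproj2_coord_vector:
  assumes c: "c \<in> A1" "p \<in> chart_dom c" and d: "d \<in> A2" "q \<in> chart_dom d"
  shows "dproj2 A1 A2 (p, q) (coord_vector (prod_atlas A1 A2) (prod_chart c d) (p, q) z) =
    coord_vector A2 d q (vec_right z)"
proof -
  let ?A = "prod_atlas A1 A2" and ?C = "prod_chart c d"
  define D where "D = (SOME C. C \<in> ?A \<and> (p, q) \<in> chart_dom C)"
  have D: "D \<in> ?A" "(p, q) \<in> chart_dom D"
    using someI_ex[of "\<lambda>C. C \<in> ?A \<and> (p, q) \<in> chart_dom C"]
      atlas_cover[OF differentiable_atlas_prod, of "(p, q)"] by (auto simp: D_def)
  then obtain c' d' where c': "D = prod_chart c' d'" "c' \<in> A1" "d' \<in> A2" "p \<in> chart_dom c'" "q \<in> chart_dom d'"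
    by (auto simp: prod_atlas_def)
  have C: "?C \<in> ?A" "(p, q) \<in> chart_dom ?C"
    using c d by (auto simp: prod_atlas_def)
  have "frechet_derivative (chart_map e \<circ> snd \<circ> chart_inv D) (at (chart_map D (p, q)))
      (frechet_derivative (chart_map D \<circ> chart_inv ?C) (at (chart_map ?C (p, q))) z) =
    frechet_derivative (chart_map e \<circ> chart_inv d) (at (chart_map d q)) (vec_right z)"
    if e: "e \<in> A2" "q \<in> chart_dom e" for e
  proof -
    have dD: "(chart_map e \<circ> snd \<circ> chart_inv D) differentiable at (chart_map D (p, q))"
      using has_derivative_snd_prod_chart[OF c'(2,4,3,5) e] unfolding c'(1) differentiable_def by blast
    show ?thesis
      using has_derivative_unique[OF has_derivative_snd_prod_chart[OF c d e]
        has_derivative_change_chart[OF differentiable_atlas_prod C D dD[unfolded frechet_derivative_works]]]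
      by (simp add: fun_eq_iff)
  qed
  then show ?thesis
    using D by (auto simp: dproj2_def differential_def Let_def D_def[symmetric] coord_vector_def fun_eq_iff)
qed

end


section \<open>The fundamental tensor of a Finsler metric\<close>

lemma has_field_derivative_line:
  fixes g :: "'a::real_normed_vector \<times> 'b::real_normed_vector \<Rightarrow> real"
  assumes "g differentiable (at (x, z))"
  shows "((\<lambda>t. g (x, z + t *\<^sub>R v)) has_field_derivative frechet_derivative g (at (x, z)) (0, v)) (at 0)"
proof -
  \<comment> \<open>The base point is written as the line at parameter 0 so that the chain rule
    matches.\<close>
  have g: "(g has_derivative frechet_derivative g (at (x, z))) (at (x, z + 0 *\<^sub>R v))"
    using assms by (simp add: frechet_derivative_works)
  have "((\<lambda>t. (x, z + t *\<^sub>R v)) has_derivative (\<lambda>t. (0, t *\<^sub>R v))) (at (0::real))"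
    by (auto intro!: derivative_eq_intros)
  from diff_chain_at[OF this g]
  have "((\<lambda>t. g (x, z + t *\<^sub>R v)) has_derivative
      (\<lambda>t. frechet_derivative g (at (x, z)) (t *\<^sub>R (0, v)))) (at 0)"
    by (simp add: comp_def)
  moreover have "frechet_derivative g (at (x, z)) (t *\<^sub>R (0, v)) =
      frechet_derivative g (at (x, z)) (0, v) * t" for t
    using linear_scale[OF has_derivative_linear[OF g], of t "(0, v)"] by simp
  ultimately show ?thesis
    by (simp only: has_field_derivative_def)
qed

section \<open>Derivatives of a smooth function along the fibres\<close>

context
  fixes E :: "'a::real_normed_vector \<times> (real^'n::finite) \<Rightarrow> real" and U :: "'a set"
  assumes E: "smooth_on (U \<times> (UNIV - {0})) E"
begin

text \<open>The partial derivative in the vector variable, taken as a total derivative in a vertical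
  direction: \<open>Ck_on\<close> speaks of derivatives in fixed directions, so regularity in base
  point and vector jointly comes straight from smoothness.\<close>

definition fiber_deriv :: "'n \<Rightarrow> 'a \<times> (real^'n) \<Rightarrow> real" where
  "fiber_deriv j w = frechet_derivative E (at w) (0, axis j 1)"

definition fiber_deriv2 :: "'n \<Rightarrow> 'n \<Rightarrow> 'a \<times> (real^'n) \<Rightarrow> real" where
  "fiber_deriv2 i j w = frechet_derivative (fiber_deriv j) (at w) (0, axis i 1)"

lemma fiber_deriv_differentiable:
  assumes "w \<in> U \<times> (UNIV - {0})"
  shows "E differentiable (at w)" "fiber_deriv j differentiable (at w)"
proof -
  have "Ck_on (Suc (Suc 0)) (U \<times> (UNIV - {0})) E"
    using E by (simp only: smooth_on_def)
  then show "E differentiable (at w)" "fiber_deriv j differentiable (at w)"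
    unfolding Ck_on.simps fiber_deriv_def[abs_def] using assms by blast+
qed

lemma continuous_fiber_deriv:
  "continuous_on (U \<times> (UNIV - {0})) E"
  "continuous_on (U \<times> (UNIV - {0})) (fiber_deriv j)"
  "continuous_on (U \<times> (UNIV - {0})) (fiber_deriv2 i j)"
proof -
  \<comment> \<open>Unfolding \<open>Ck_on\<close> at level k ends in continuity of the k-fold
    directional derivatives.\<close>
  have "Ck_on 0 (U \<times> (UNIV - {0})) E" "Ck_on (Suc 0) (U \<times> (UNIV - {0})) E"
      "Ck_on (Suc (Suc 0)) (U \<times> (UNIV - {0})) E"
    using E by (simp_all only: smooth_on_def)
  then show "continuous_on (U \<times> (UNIV - {0})) E"
      "continuous_on (U \<times> (UNIV - {0})) (fiber_deriv j)"
      "continuous_on (U \<times> (UNIV - {0})) (fiber_deriv2 i j)"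
    unfolding Ck_on.simps fiber_deriv2_def[abs_def] fiber_deriv_def[abs_def] by blast+
qed

lemma fiber_square_deriv:
  assumes "x \<in> U" "z \<noteq> 0"
  shows "((\<lambda>t. (E (x, z + t *\<^sub>R axis j 1))\<^sup>2) has_field_derivative
    2 * (E (x, z) * fiber_deriv j (x, z))) (at 0)"
proof -
  have "((\<lambda>t. E (x, z + t *\<^sub>R axis j 1)) has_field_derivative fiber_deriv j (x, z)) (at 0)"
    unfolding fiber_deriv_def
    using assms by (intro has_field_derivative_line fiber_deriv_differentiable) auto
  from DERIV_power[OF this, of 2] show ?thesis
    by (simp add: mult_ac)
qed

lemma fiber_square_partial:
  assumes "x \<in> U" "z \<noteq> 0"
  shows "partial_deriv j (\<lambda>z. (E (x, z))\<^sup>2) z = 2 * (E (x, z) * fiber_deriv j (x, z))"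
  using assms by (intro partial_derivI fiber_square_deriv)

lemma fiber_square_deriv2:
  assumes "x \<in> U" "z \<noteq> 0"
  shows "((\<lambda>t. partial_deriv j (\<lambda>z. (E (x, z))\<^sup>2) (z + t *\<^sub>R axis i 1)) has_field_derivative
    2 * (fiber_deriv i (x, z) * fiber_deriv j (x, z) + E (x, z) * fiber_deriv2 i j (x, z))) (at 0)"
proof -
  have "((\<lambda>t. E (x, z + t *\<^sub>R axis i 1)) has_field_derivative fiber_deriv i (x, z)) (at 0)"
    unfolding fiber_deriv_def
    using assms by (intro has_field_derivative_line fiber_deriv_differentiable) auto
  moreover have "((\<lambda>t. fiber_deriv j (x, z + t *\<^sub>R axis i 1)) has_field_derivative
      fiber_deriv2 i j (x, z)) (at 0)"
    unfolding fiber_deriv2_def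
    using assms by (intro has_field_derivative_line fiber_deriv_differentiable) auto
  ultimately have "((\<lambda>t. 2 * (E (x, z + t *\<^sub>R axis i 1) * fiber_deriv j (x, z + t *\<^sub>R axis i 1)))
      has_field_derivative
      2 * (fiber_deriv i (x, z) * fiber_deriv j (x, z) + E (x, z) * fiber_deriv2 i j (x, z))) (at 0)"
    by (auto intro!: derivative_eq_intros simp: algebra_simps)
  then show ?thesis
    using eventually_mono[OF eventually_line_neq_0[OF assms(2), of "axis i 1"]]
    by (subst DERIV_cong_ev[OF refl _ refl]) (auto simp: fiber_square_partial assms(1))
qed

lemma fiber_square_hessian:
  assumes "x \<in> U" "z \<noteq> 0"
  shows "half_hessian (\<lambda>z. (E (x, z))\<^sup>2) z =
    (\<chi> i j. fiber_deriv i (x, z) * fiber_deriv j (x, z) + E (x, z) * fiber_deriv2 i j (x, z))"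
  unfolding half_hessian_def using partial_derivI[OF fiber_square_deriv2[OF assms]]
  by (simp add: vec_eq_iff)

text \<open>The product rule gives a formula in continuous fibre derivatives. Continuity is needed
  in both variables: in the vector for attaining extrema, in the base point for their
  measurability.\<close>

lemma continuous_fiber_hessian:
  "continuous_on (U \<times> (UNIV - {0})) (\<lambda>w. half_hessian (\<lambda>z. (E (fst w, z))\<^sup>2) (snd w))"
proof -
  have "continuous_on (U \<times> (UNIV - {0})) (\<lambda>w. \<chi> i j.
      fiber_deriv i w * fiber_deriv j w + E w * fiber_deriv2 i j w)"
    by (intro continuous_intros continuous_fiber_deriv)
  then show ?thesis
  proof (rule continuous_on_eq)
    show "(\<chi> i j. fiber_deriv i w * fiber_deriv j w + E w * fiber_deriv2 i j w) =
        half_hessian (\<lambda>z. (E (fst w, z))\<^sup>2) (snd w)" if "w \<in> U \<times> (UNIV - {0})" for w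
    proof -
      have "fst w \<in> U" "snd w \<noteq> 0"
        using that by auto
      from fiber_square_hessian[OF this] show ?thesis
        by simp
    qed
  qed
qed

text \<open>Positivity comes for free: where \<open>E\<close> vanishes it has a minimum, so its first derivatives
  vanish as well, and then so does the Hessian of \<open>E\<^sup>2\<close>.\<close>

lemma minkowski_norm_fiber:
  assumes x: "x \<in> U" and nonneg: "\<And>z. 0 \<le> E (x, z)"
    and homogeneous: "\<And>r z. 0 < r \<Longrightarrow> E (x, r *\<^sub>R z) = r * E (x, z)"
    and pd: "\<And>y w. y \<noteq> 0 \<Longrightarrow> w \<noteq> 0 \<Longrightarrow> 0 < w \<bullet> (half_hessian (\<lambda>z. (E (x, z))\<^sup>2) y *v w)"
  shows "minkowski_norm (\<lambda>z. E (x, z))"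
proof
  show "has_partials (\<lambda>z. (E (x, z))\<^sup>2)"
    using fiber_square_deriv[OF x] fiber_square_partial[OF x] by (auto simp: has_partials_def)
  show "has_partials (partial_deriv j (\<lambda>z. (E (x, z))\<^sup>2))" for j
    using fiber_square_deriv2[OF x] partial_derivI[OF fiber_square_deriv2[OF x]]
    by (auto simp: has_partials_def)
  show "continuous_on (UNIV - {0}) (half_hessian (\<lambda>z. (E (x, z))\<^sup>2))"
  proof -
    have "continuous_on (UNIV - {0}) (\<lambda>z :: real^'n. (x, z))"
      by (intro continuous_intros)
    from continuous_on_compose2[OF continuous_fiber_hessian this] x show ?thesis
      by auto
  qed
  show "0 < E (x, y)" if y: "y \<noteq> 0" for y
  proof (rule ccontr)
    assume "\<not> 0 < E (x, y)"
    then have 0: "E (x, y) = 0"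
      using nonneg[of y] by simp
    have "fiber_deriv i (x, y) = 0" for i
    proof (rule DERIV_local_min)
      show "((\<lambda>t. E (x, y + t *\<^sub>R axis i 1)) has_field_derivative fiber_deriv i (x, y)) (at 0)"
        unfolding fiber_deriv_def
        using x y by (intro has_field_derivative_line fiber_deriv_differentiable) auto
    qed (use 0 nonneg in \<open>auto intro: zero_less_one\<close>)
    then have "half_hessian (\<lambda>z. (E (x, z))\<^sup>2) y = 0"
      using x y by (simp add: fiber_square_hessian 0 vec_eq_iff)
    then show False
      using pd[OF y y] by simp
  qed
qed (use homogeneous pd in auto)

end

section \<open>From Finsler metrics to norms on single tangent spaces\<close>

lemma fundamental_tensor_hessian:
  "fundamental_tensor A F c p = half_hessian (\<lambda>z. (F p (coord_vector A c p z))\<^sup>2)"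
  by (simp add: fun_eq_iff fundamental_tensor_def half_hessian_def)

context
  fixes A :: "('m::topological_space, 'n::finite) chart set" and F :: "('m, 'n) tm_fun"
  assumes A: "differentiable_atlas A" and F: "finsler_metric A F"
begin

lemma finsler_minkowski_norm:
  assumes c: "c \<in> A" "p \<in> chart_dom c"
  shows "minkowski_norm (\<lambda>z. F p (coord_vector A c p z))"
proof -
  let ?E = "coord_expr A F c"
  have E: "?E (chart_map c p, z) = F p (coord_vector A c p z)" for z
    using c by (simp add: coord_expr_def is_chart_inverse[OF atlas_chart[OF A c(1)]])
  have "minkowski_norm (\<lambda>z. ?E (chart_map c p, z))"
  proof (rule minkowski_norm_fiber)
    show "smooth_on (chart_image c \<times> (UNIV - {0})) ?E" "chart_map c p \<in> chart_image c"
      using F c by (auto simp: finsler_metric_def)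
    show "0 \<le> ?E (chart_map c p, z)" for z
      using F coord_vector_tangent[OF A c] by (simp add: E finsler_metric_def)
    show "?E (chart_map c p, r *\<^sub>R z) = r * ?E (chart_map c p, z)" if "0 < r" for r z
      using F coord_vector_tangent[OF A c] that
      by (simp add: E coord_vector_scaleR[OF A c] finsler_metric_def)
    show "0 < w \<bullet> (half_hessian (\<lambda>z. (?E (chart_map c p, z))\<^sup>2) y *v w)"
      if "y \<noteq> 0" "w \<noteq> 0" for y w
      using F c that by (simp add: E fundamental_tensor_hessian[symmetric] finsler_metric_def)
  qed
  then show ?thesis
    by (simp add: E)
qed

lemma continuous_det_fundamental_tensor:
  assumes c: "c \<in> A"
  shows "continuous_on (chart_image c \<times> (UNIV - {0}))
    (\<lambda>w. sqrt (det (fundamental_tensor A F c (chart_inv c (fst w)) (snd w))))"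
proof -
  have "continuous_on (chart_image c \<times> (UNIV - {0}))
      (\<lambda>w. half_hessian (\<lambda>z. (coord_expr A F c (fst w, z))\<^sup>2) (snd w))"
    using F c by (intro continuous_fiber_hessian) (auto simp: finsler_metric_def)
  then show ?thesis
    unfolding det_def fundamental_tensor_hessian coord_expr_def
    by (auto intro!: continuous_intros)
qed

end


section \<open>Extremal densities\<close>

abbreviation finsler_density ::
    "('m, 'n::finite) chart set \<Rightarrow> ('m, 'n) tm_fun \<Rightarrow> ('m, 'n) chart \<Rightarrow> 'm \<Rightarrow> real^'n \<Rightarrow> real" where
  "finsler_density A F c p y \<equiv> sqrt (det (fundamental_tensor A F c p y))"

text \<open>Phrased with images so that the whole set of densities on the indicatrix can be
  rewritten at once.\<close>

lemma sigma_max_eqI: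
  assumes "s \<in> finsler_density A F c p ` (\<lambda>v. v c) ` indicatrix D F p"
    and "\<And>t. t \<in> finsler_density A F c p ` (\<lambda>v. v c) ` indicatrix D F p \<Longrightarrow> t \<le> s"
  shows "sigma_max A D F c p = s"
  unfolding sigma_max_def using assms by (intro Greatest_equality) auto

lemma sigma_min_eqI:
  assumes "s \<in> finsler_density A F c p ` (\<lambda>v. v c) ` indicatrix D F p"
    and "\<And>t. t \<in> finsler_density A F c p ` (\<lambda>v. v c) ` indicatrix D F p \<Longrightarrow> s \<le> t"
  shows "sigma_min A D F c p = s"
  unfolding sigma_min_def using assms by (intro Least_equality) auto

section \<open>Extremal densities of one Finsler metric and their measurability\<close>

context
  fixes A :: "('m::topological_space, 'n::finite) chart set" and F :: "('m, 'n) tm_fun"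
  assumes A: "differentiable_atlas A" and F: "finsler_metric A F"
begin

lemma slit_indicatrix_coordinates:
  assumes c: "c \<in> A" "p \<in> chart_dom c"
  shows "(\<lambda>v. v c) ` indicatrix (slit_tangent A) F p =
    {y. y \<noteq> 0 \<and> F p (coord_vector A c p y) = 1}" (is "?L = ?R")
proof
  show "?L \<subseteq> ?R"
  proof
    fix y assume "y \<in> ?L"
    then obtain v where v: "v \<in> tangent_space A p" "v \<noteq> (\<lambda>c. 0)" "F p v = 1" "y = v c"
      by (auto simp: indicatrix_def slit_tangent_def)
    have "coord_vector A c p y = v"
      using coord_vector_coordinates[OF A c v(1)] v(4) by simp
    then show "y \<in> ?R"
      using v coord_vector_0_iff[OF A c, of y] by auto
  qed
  show "?R \<subseteq> ?L"
    using coord_vector_tangent[OF A c] coord_vector_0_iff[OF A c] coord_vector_self[OF A c, symmetric]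
    by (auto simp: indicatrix_def slit_tangent_def)
qed

lemma slit_densities:
  assumes c: "c \<in> A" "p \<in> chart_dom c"
  shows "finsler_density A F c p ` (\<lambda>v. v c) ` indicatrix (slit_tangent A) F p =
    finsler_density A F c p ` (- {0})"
  unfolding slit_indicatrix_coordinates[OF c] fundamental_tensor_hessian
  using minkowski_norm.density_unit[OF finsler_minkowski_norm[OF A F c]] .

lemma finsler_density_pos:
  "c \<in> A \<Longrightarrow> p \<in> chart_dom c \<Longrightarrow> y \<noteq> 0 \<Longrightarrow> 0 < finsler_density A F c p y"
  unfolding fundamental_tensor_hessian
  using minkowski_norm.density_pos[OF finsler_minkowski_norm[OF A F]] .

lemma compact_finsler_densities:
  assumes c: "c \<in> A" "p \<in> chart_dom c"
  shows "compact (finsler_density A F c p ` (- {0}))" "finsler_density A F c p ` (- {0}) \<noteq> {}"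
  unfolding fundamental_tensor_hessian
  using minkowski_norm.compact_densities[OF finsler_minkowski_norm[OF A F c]]
    minkowski_norm.densities_nonempty[OF finsler_minkowski_norm[OF A F c]] .

text \<open>A nonempty compact set of densities has a largest element. By 0-homogeneity the
  comparison extends from the indicatrix to all nonzero vectors.\<close>

lemma sigma_max_slit:
  assumes c: "c \<in> A" "p \<in> chart_dom c"
  shows "sigma_max A (slit_tangent A) F c p \<in> finsler_density A F c p ` (- {0})"
    and "y \<noteq> 0 \<Longrightarrow> finsler_density A F c p y \<le> sigma_max A (slit_tangent A) F c p"
proof -
  obtain s where s: "s \<in> finsler_density A F c p ` (- {0})"
      "\<And>t. t \<in> finsler_density A F c p ` (- {0}) \<Longrightarrow> t \<le> s"
    using compact_attains_sup[OF compact_finsler_densities[OF c]] by blast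
  then have eq: "sigma_max A (slit_tangent A) F c p = s"
    by (intro sigma_max_eqI) (simp_all only: slit_densities[OF c])
  show "sigma_max A (slit_tangent A) F c p \<in> finsler_density A F c p ` (- {0})"
    unfolding eq by (rule s(1))
  show "finsler_density A F c p y \<le> sigma_max A (slit_tangent A) F c p" if "y \<noteq> 0"
    unfolding eq using that by (intro s(2) imageI) simp
qed

lemma sigma_min_slit:
  assumes c: "c \<in> A" "p \<in> chart_dom c"
  shows "sigma_min A (slit_tangent A) F c p \<in> finsler_density A F c p ` (- {0})"
    and "y \<noteq> 0 \<Longrightarrow> sigma_min A (slit_tangent A) F c p \<le> finsler_density A F c p y"
proof -
  obtain s where s: "s \<in> finsler_density A F c p ` (- {0})"
      "\<And>t. t \<in> finsler_density A F c p ` (- {0}) \<Longrightarrow> s \<le> t"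
    using compact_attains_inf[OF compact_finsler_densities[OF c]] by blast
  then have eq: "sigma_min A (slit_tangent A) F c p = s"
    by (intro sigma_min_eqI) (simp_all only: slit_densities[OF c])
  show "sigma_min A (slit_tangent A) F c p \<in> finsler_density A F c p ` (- {0})"
    unfolding eq by (rule s(1))
  show "sigma_min A (slit_tangent A) F c p \<le> finsler_density A F c p y" if "y \<noteq> 0"
    unfolding eq using that by (intro s(2) imageI) simp
qed

lemma sigma_slit_pos:
  assumes c: "c \<in> A" "p \<in> chart_dom c"
  shows "0 < sigma_max A (slit_tangent A) F c p" "0 < sigma_min A (slit_tangent A) F c p"
  using sigma_max_slit(1)[OF c] sigma_min_slit(1)[OF c]
  by (metis (no_types, lifting) ComplD finsler_density_pos[OF c] imageE singletonI)+

text \<open>A maximum exceeds \<open>a\<close> exactly when some density does, so inside the chart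
  image the superlevel set is the projection of an open set of pairs (point, vector), and
  projections are open maps.\<close>

lemma borel_measurable_sigma_max:
  assumes c: "c \<in> A"
  shows "(\<lambda>x. if x \<in> chart_image c then sigma_max A (slit_tangent A) F c (chart_inv c x) else 0)
    \<in> borel_measurable borel" (is "?s \<in> _")
proof (rule borel_measurable_iff_greater[THEN iffD2, rule_format])
  fix a :: real
  let ?U = "chart_image c" and ?G = "\<lambda>w. finsler_density A F c (chart_inv c (fst w)) (snd w)"
  have U: "open ?U"
    using atlas_chart[OF A c] by (rule is_chart_open)
  have "open (?U \<times> (UNIV - {0 :: real^'n}))"
    using U by (intro open_Times) auto
  then have "open ((?U \<times> (UNIV - {0})) \<inter> ?G -` {a<..})"
    by (intro continuous_open_preimage[OF continuous_det_fundamental_tensor[OF A F c]]) auto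
  then have op: "open (fst ` ((?U \<times> (UNIV - {0})) \<inter> ?G -` {a<..}))"
    by (rule open_image_fst)
  have "a < sigma_max A (slit_tangent A) F c (chart_inv c x) \<longleftrightarrow>
      (\<exists>y. y \<noteq> 0 \<and> a < finsler_density A F c (chart_inv c x) y)" if "x \<in> ?U" for x
  proof -
    have p: "chart_inv c x \<in> chart_dom c"
      using is_chart_inverse(3)[OF atlas_chart[OF A c] that] .
    show ?thesis
      using sigma_max_slit[OF c p] by (auto intro: less_le_trans)
  qed
  moreover have "fst ` ((?U \<times> (UNIV - {0})) \<inter> ?G -` {a<..}) =
      {x \<in> ?U. \<exists>y. y \<noteq> 0 \<and> a < finsler_density A F c (chart_inv c x) y}"
    by force
  \<comment> \<open>Off the chart image the function is 0, so the complement belongs to the set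
    precisely for negative \<open>a\<close>.\<close>
  ultimately have "{x \<in> space borel. a < ?s x} =
      fst ` ((?U \<times> (UNIV - {0})) \<inter> ?G -` {a<..}) \<union> (if a < 0 then - ?U else {})"
    by (auto split: if_splits)
  moreover have "- ?U \<in> sets borel"
    using U by auto
  ultimately show "{x \<in> space borel. a < ?s x} \<in> sets borel"
    using op by auto
qed

text \<open>Dually, a minimum lies below \<open>a\<close> exactly when some density does, so here
  the sublevel sets are projections of open sets.\<close>

lemma borel_measurable_sigma_min:
  assumes c: "c \<in> A"
  shows "(\<lambda>x. if x \<in> chart_image c then sigma_min A (slit_tangent A) F c (chart_inv c x) else 0)
    \<in> borel_measurable borel" (is "?s \<in> _")
proof (rule borel_measurable_iff_less[THEN iffD2, rule_format])
  fix a :: real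
  let ?U = "chart_image c" and ?G = "\<lambda>w. finsler_density A F c (chart_inv c (fst w)) (snd w)"
  have U: "open ?U"
    using atlas_chart[OF A c] by (rule is_chart_open)
  have "open (?U \<times> (UNIV - {0 :: real^'n}))"
    using U by (intro open_Times) auto
  then have "open ((?U \<times> (UNIV - {0})) \<inter> ?G -` {..<a})"
    by (intro continuous_open_preimage[OF continuous_det_fundamental_tensor[OF A F c]]) auto
  then have op: "open (fst ` ((?U \<times> (UNIV - {0})) \<inter> ?G -` {..<a}))"
    by (rule open_image_fst)
  have "sigma_min A (slit_tangent A) F c (chart_inv c x) < a \<longleftrightarrow>
      (\<exists>y. y \<noteq> 0 \<and> finsler_density A F c (chart_inv c x) y < a)" if "x \<in> ?U" for x
  proof -
    have p: "chart_inv c x \<in> chart_dom c"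
      using is_chart_inverse(3)[OF atlas_chart[OF A c] that] .
    show ?thesis
      using sigma_min_slit[OF c p] by (auto intro: le_less_trans)
  qed
  moreover have "fst ` ((?U \<times> (UNIV - {0})) \<inter> ?G -` {..<a}) =
      {x \<in> ?U. \<exists>y. y \<noteq> 0 \<and> finsler_density A F c (chart_inv c x) y < a}"
    by force
  ultimately have "{x \<in> space borel. ?s x < a} =
      fst ` ((?U \<times> (UNIV - {0})) \<inter> ?G -` {..<a}) \<union> (if 0 < a then - ?U else {})"
    by (auto split: if_splits)
  moreover have "- ?U \<in> sets borel"
    using U by auto
  ultimately show "{x \<in> space borel. ?s x < a} \<in> sets borel"
    using op by auto
qed

end

section \<open>Extremal densities of the warped product\<close>

context
  fixes A1 :: "('m::topological_space, 'n::finite) chart set" and F1 :: "('m, 'n) tm_fun"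
    and A2 :: "('k::topological_space, 'l::finite) chart set" and F2 :: "('k, 'l) tm_fun"
    and f :: "'m \<Rightarrow> real"
  assumes A1: "differentiable_atlas A1" and F1: "finsler_metric A1 F1"
    and A2: "differentiable_atlas A2" and F2: "finsler_metric A2 F2"
    and f: "\<And>p. 0 < f p"
begin

lemma warped_metric_coordinates:
  assumes c: "c \<in> A1" "p \<in> chart_dom c" and d: "d \<in> A2" "q \<in> chart_dom d"
  shows "warped_metric A1 F1 f A2 F2 (p, q) (coord_vector (prod_atlas A1 A2) (prod_chart c d) (p, q) z) =
    sqrt ((F1 p (coord_vector A1 c p (vec_left z)))\<^sup>2 +
      (f p)\<^sup>2 * (F2 q (coord_vector A2 d q (vec_right z)))\<^sup>2)"
  by (simp add: warped_metric_def dproj1_coord_vector[OF A1 A2 assms] dproj2_coord_vector[OF A1 A2 assms])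

text \<open>Coordinates in the product chart identify the warped indicatrix with the set treated in
  \<open>warped_density_image\<close>; the two nonvanishing projections become the two nonzero
  halves of the coordinate vector.\<close>

lemma warped_densities:
  assumes c: "c \<in> A1" "p \<in> chart_dom c" and d: "d \<in> A2" "q \<in> chart_dom d"
  defines "C \<equiv> prod_chart c d" and "W \<equiv> warped_metric A1 F1 f A2 F2"
  shows "finsler_density (prod_atlas A1 A2) W C (p, q) `
      (\<lambda>v. v C) ` indicatrix (warped_slit_tangent A1 A2) W (p, q) =
    (\<lambda>(s, t). f p ^ CARD('l) * s * t) `
      (finsler_density A1 F1 c p ` (- {0}) \<times> finsler_density A2 F2 d q ` (- {0}))"
proof -
  let ?A = "prod_atlas A1 A2"
  let ?W = "\<lambda>z. sqrt ((F1 p (coord_vector A1 c p (vec_left z)))\<^sup>2 +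
      (f p)\<^sup>2 * (F2 q (coord_vector A2 d q (vec_right z)))\<^sup>2)"
  have A: "differentiable_atlas ?A"
    using A1 A2 by (rule differentiable_atlas_prod)
  have C: "C \<in> ?A" "(p, q) \<in> chart_dom C"
    using c d by (auto simp: prod_atlas_def C_def)
  have W: "W (p, q) (coord_vector ?A C (p, q) z) = ?W z" for z
    unfolding W_def C_def by (rule warped_metric_coordinates[OF c d])
  have regular: "coord_vector ?A C (p, q) z \<in> warped_slit_tangent A1 A2 (p, q) \<longleftrightarrow>
      vec_left z \<noteq> 0 \<and> vec_right z \<noteq> 0" for z
    unfolding warped_slit_tangent_def using coord_vector_tangent[OF A C]
    by (simp add: C_def dproj1_coord_vector[OF A1 A2 c d] dproj2_coord_vector[OF A1 A2 c d]
        coord_vector_0_iff[OF A1 c] coord_vector_0_iff[OF A2 d])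
  have "(\<lambda>v. v C) ` indicatrix (warped_slit_tangent A1 A2) W (p, q) =
      {z. vec_left z \<noteq> 0 \<and> vec_right z \<noteq> 0 \<and> ?W z = 1}" (is "?L = ?R")
  proof
    show "?L \<subseteq> ?R"
    proof
      fix z assume "z \<in> ?L"
      then obtain v where v: "v \<in> warped_slit_tangent A1 A2 (p, q)" "W (p, q) v = 1" "z = v C"
        by (auto simp: indicatrix_def)
      then have "coord_vector ?A C (p, q) z = v"
        using coord_vector_coordinates[OF A C, of v] by (simp add: warped_slit_tangent_def)
      then show "z \<in> ?R"
        using v regular[of z] W[of z] by simp
    qed
    show "?R \<subseteq> ?L"
    proof
      fix z assume "z \<in> ?R"
      then have "coord_vector ?A C (p, q) z \<in> indicatrix (warped_slit_tangent A1 A2) W (p, q)"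
        using regular[of z] W[of z] by (simp add: indicatrix_def)
      then show "z \<in> ?L"
        using coord_vector_self[OF A C, of z] by (metis image_eqI)
    qed
  qed
  moreover have "finsler_density ?A W C (p, q) = (\<lambda>z. sqrt (det (half_hessian (\<lambda>z. (?W z)\<^sup>2) z)))"
    by (simp only: fundamental_tensor_hessian W)
  ultimately show ?thesis
    unfolding fundamental_tensor_hessian
    using warped_density_image[OF finsler_minkowski_norm[OF A1 F1 c] finsler_minkowski_norm[OF A2 F2 d] f[of p]]
    by (simp only:)
qed

text \<open>The two densities range independently over positive values, so the maximum of the
  product is the product of the maxima.\<close>

lemma warped_sigma_max:
  assumes c: "c \<in> A1" "p \<in> chart_dom c" and d: "d \<in> A2" "q \<in> chart_dom d"
  shows "sigma_max (prod_atlas A1 A2) (warped_slit_tangent A1 A2) (warped_metric A1 F1 f A2 F2)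
      (prod_chart c d) (p, q) =
    f p ^ CARD('l) * sigma_max A1 (slit_tangent A1) F1 c p * sigma_max A2 (slit_tangent A2) F2 d q"
proof (rule sigma_max_eqI, unfold warped_densities[OF c d])
  fix u assume "u \<in> (\<lambda>(s, t). f p ^ CARD('l) * s * t) `
      (finsler_density A1 F1 c p ` (- {0}) \<times> finsler_density A2 F2 d q ` (- {0}))"
  then obtain x y where "x \<noteq> 0" "y \<noteq> 0"
      "u = f p ^ CARD('l) * finsler_density A1 F1 c p x * finsler_density A2 F2 d q y"
    by auto
  then show "u \<le> f p ^ CARD('l) * sigma_max A1 (slit_tangent A1) F1 c p *
      sigma_max A2 (slit_tangent A2) F2 d q"
    using f[of p] sigma_max_slit(2)[OF A1 F1 c] sigma_max_slit(2)[OF A2 F2 d]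
      finsler_density_pos[OF A1 F1 c] finsler_density_pos[OF A2 F2 d]
      sigma_slit_pos(1)[OF A1 F1 c]
    by (auto intro!: mult_mono mult_nonneg_nonneg intro: less_imp_le)
\<comment> \<open>The remaining goal is attainment, witnessed by the pair of maximal
  densities.\<close>
qed (use sigma_max_slit(1)[OF A1 F1 c] sigma_max_slit(1)[OF A2 F2 d] in \<open>auto intro!: rev_image_eqI\<close>)

lemma warped_sigma_min:
  assumes c: "c \<in> A1" "p \<in> chart_dom c" and d: "d \<in> A2" "q \<in> chart_dom d"
  shows "sigma_min (prod_atlas A1 A2) (warped_slit_tangent A1 A2) (warped_metric A1 F1 f A2 F2)
      (prod_chart c d) (p, q) =
    f p ^ CARD('l) * sigma_min A1 (slit_tangent A1) F1 c p * sigma_min A2 (slit_tangent A2) F2 d q"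
proof (rule sigma_min_eqI, unfold warped_densities[OF c d])
  fix u assume "u \<in> (\<lambda>(s, t). f p ^ CARD('l) * s * t) `
      (finsler_density A1 F1 c p ` (- {0}) \<times> finsler_density A2 F2 d q ` (- {0}))"
  then obtain x y where "x \<noteq> 0" "y \<noteq> 0"
      "u = f p ^ CARD('l) * finsler_density A1 F1 c p x * finsler_density A2 F2 d q y"
    by auto
  then show "f p ^ CARD('l) * sigma_min A1 (slit_tangent A1) F1 c p *
      sigma_min A2 (slit_tangent A2) F2 d q \<le> u"
    using f[of p] sigma_min_slit(2)[OF A1 F1 c] sigma_min_slit(2)[OF A2 F2 d]
      finsler_density_pos[OF A1 F1 c] sigma_slit_pos(2)[OF A1 F1 c] sigma_slit_pos(2)[OF A2 F2 d]
    by (auto intro!: mult_mono mult_nonneg_nonneg intro: less_imp_le)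
qed (use sigma_min_slit(1)[OF A1 F1 c] sigma_min_slit(1)[OF A2 F2 d] in \<open>auto intro!: rev_image_eqI\<close>)

end


section \<open>Volume measures\<close>

text \<open>Extension by 0 gives a density on all of \<open>real^'n\<close>, so that integrals over
  chart images become integrals over the whole space.\<close>

definition chart_density :: "('m, 'n::finite) chart \<Rightarrow> ('m \<Rightarrow> real) \<Rightarrow> real^'n \<Rightarrow> real" where
  "chart_density c s x = (if x \<in> chart_image c then s (chart_inv c x) else 0)"

text \<open>The inverse chart completed by a constant to a total Borel map; the chosen value carries
  no mass, since \<open>chart_density\<close> is 0 there.\<close>

definition chart_param :: "('m, 'n::finite) chart \<Rightarrow> real^'n \<Rightarrow> 'm" where
  "chart_param c x = (if x \<in> chart_image c then chart_inv c x else undefined)"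

lemma borel_measurable_chart_param:
  assumes c: "is_chart c"
  shows "chart_param c \<in> borel_measurable borel"
  unfolding chart_param_def[abs_def]
  using is_chart_open(2)[OF c] is_chart_continuous(2)[OF c]
  by (intro borel_measurable_continuous_on_if) auto

text \<open>Recasts the defining integral formula as an equality of measures: the restriction to a
  chart domain is a push-forward from coordinate space. In this form the product rules for densities
  and push-forwards apply.\<close>

lemma volume_measure_chart:
  fixes c :: "('m::topological_space, 'n::finite) chart"
  assumes c: "c \<in> A" "is_chart c" and \<mu>: "is_volume_measure A \<sigma> \<mu>"
    and s: "chart_density c (\<sigma> c) \<in> borel_measurable borel"
  shows "density \<mu> (indicator (chart_dom c)) =
    distr (density lborel (\<lambda>x. ennreal (chart_density c (\<sigma> c) x))) borel (chart_param c)"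
proof (rule measure_eqI)
  note [measurable] = borel_measurable_chart_param[OF c(2)] s
  have sets: "sets \<mu> = sets borel"
    using \<mu> by (simp add: is_volume_measure_def)
  then show "sets (density \<mu> (indicator (chart_dom c))) =
      sets (distr (density lborel (\<lambda>x. ennreal (chart_density c (\<sigma> c) x))) borel (chart_param c))"
    by simp
  fix B assume "B \<in> sets (density \<mu> (indicator (chart_dom c)))"
  then have B: "B \<in> sets \<mu>" and B' [measurable]: "B \<in> sets borel"
    using sets by auto
  have dom: "chart_dom c \<in> sets borel"
    using is_chart_open(1)[OF c(2)] by simp
  have "emeasure (density \<mu> (indicator (chart_dom c))) B = emeasure \<mu> (chart_dom c \<inter> B)"
    using B dom sets by (subst emeasure_density)
      (auto simp: indicator_inter_arith[symmetric] borel_measurable_indicator)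
  also have "\<dots> = (\<integral>\<^sup>+x\<in>chart_map c ` (chart_dom c \<inter> B). ennreal (\<sigma> c (chart_inv c x)) \<partial>lborel)"
    using \<mu> c(1) B' dom by (simp add: is_volume_measure_def)
  \<comment> \<open>Off the chart image both integrands vanish, the first by its indicator and the
    second by its density.\<close>
  also have "\<dots> = (\<integral>\<^sup>+x. ennreal (chart_density c (\<sigma> c) x) * indicator (chart_param c -` B) x \<partial>lborel)"
    using is_chart_inverse[OF c(2)]
    by (intro nn_integral_cong)
      (auto simp: chart_density_def chart_param_def split: split_indicator)
  also have "\<dots> = emeasure (density lborel (\<lambda>x. ennreal (chart_density c (\<sigma> c) x))) (chart_param c -` B)"
    using measurable_sets[OF borel_measurable_chart_param[OF c(2)] B']
    by (subst emeasure_density) auto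
  also have "\<dots> = emeasure (distr (density lborel (\<lambda>x. ennreal (chart_density c (\<sigma> c) x))) borel (chart_param c)) B"
    by (subst emeasure_distr) auto
  finally show "emeasure (density \<mu> (indicator (chart_dom c))) B =
    emeasure (distr (density lborel (\<lambda>x. ennreal (chart_density c (\<sigma> c) x))) borel (chart_param c)) B" .
qed

text \<open>Inside a product of chart domains both factors may be restricted to those domains and
  written as push-forwards of Lebesgue densities. Their product is then a push-forward from the
  product of coordinate spaces, and \<open>lborel_vec_join\<close> turns this into the product
  chart.\<close>

lemma is_volume_measure_prod:
  fixes A1 :: "('m::{t2_space, second_countable_topology}, 'n::finite) chart set"
    and A2 :: "('k::{t2_space, second_countable_topology}, 'l::finite) chart set"
  assumes charts: "\<And>c. c \<in> A1 \<Longrightarrow> is_chart c" "\<And>d. d \<in> A2 \<Longrightarrow> is_chart d"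
    and \<mu>1: "is_volume_measure A1 \<sigma>1 \<mu>1" "finite_measure \<mu>1"
    and \<mu>2: "is_volume_measure A2 \<sigma>2 \<mu>2" "finite_measure \<mu>2"
    and meas: "\<And>c. c \<in> A1 \<Longrightarrow> chart_density c (\<sigma>1 c) \<in> borel_measurable borel"
      "\<And>d. d \<in> A2 \<Longrightarrow> chart_density d (\<sigma>2 d) \<in> borel_measurable borel"
    and nonneg: "\<And>c p. c \<in> A1 \<Longrightarrow> p \<in> chart_dom c \<Longrightarrow> 0 \<le> \<sigma>1 c p"
      "\<And>d q. d \<in> A2 \<Longrightarrow> q \<in> chart_dom d \<Longrightarrow> 0 \<le> \<sigma>2 d q"
    and g: "g \<in> borel_measurable borel" "\<And>p. 0 \<le> g p"
    and \<sigma>: "\<And>c d p q. c \<in> A1 \<Longrightarrow> p \<in> chart_dom c \<Longrightarrow> d \<in> A2 \<Longrightarrow> q \<in> chart_dom d \<Longrightarrow>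
      \<sigma> (prod_chart c d) (p, q) = g p * \<sigma>1 c p * \<sigma>2 d q"
  shows "is_volume_measure (prod_atlas A1 A2) \<sigma> (density (\<mu>1 \<Otimes>\<^sub>M \<mu>2) (\<lambda>(p, q). ennreal (g p)))"
proof -
  note [measurable] = g(1)
  have sets1 [measurable_cong]: "sets \<mu>1 = sets borel" and sets2 [measurable_cong]: "sets \<mu>2 = sets borel"
    using \<mu>1 \<mu>2 by (auto simp: is_volume_measure_def)
  interpret \<mu>1: finite_measure \<mu>1 by fact
  interpret \<mu>2: finite_measure \<mu>2 by fact
  have sets: "sets (\<mu>1 \<Otimes>\<^sub>M \<mu>2) = sets borel"
    unfolding sets_pair_measure_cong[OF sets1 sets2] borel_prod ..
  have "emeasure (density (\<mu>1 \<Otimes>\<^sub>M \<mu>2) (\<lambda>(p, q). ennreal (g p))) B =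
      (\<integral>\<^sup>+z\<in>chart_map (prod_chart c d) ` B.
        ennreal (\<sigma> (prod_chart c d) (chart_inv (prod_chart c d) z)) \<partial>lborel)"
    if c: "c \<in> A1" and d: "d \<in> A2" and B: "B \<in> sets borel" "B \<subseteq> chart_dom c \<times> chart_dom d" for c d B
  proof -
    let ?s1 = "\<lambda>x. ennreal (chart_density c (\<sigma>1 c) x)" and ?s2 = "\<lambda>y. ennreal (chart_density d (\<sigma>2 d) y)"
    let ?r1 = "chart_param c" and ?r2 = "chart_param d"
    let ?D1 = "density \<mu>1 (indicator (chart_dom c))" and ?D2 = "density \<mu>2 (indicator (chart_dom d))"
    let ?h = "\<lambda>(p, q). ennreal (g p) * indicator B (p, q)"
    have ch: "is_chart c" "is_chart d"
      using charts c d by auto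
    note [measurable] = meas(1)[OF c] meas(2)[OF d] borel_measurable_chart_param[OF ch(1)]
      borel_measurable_chart_param[OF ch(2)]
    have dom [measurable]: "chart_dom c \<in> sets borel" "chart_dom d \<in> sets borel"
      using is_chart_open(1)[OF ch(1)] is_chart_open(1)[OF ch(2)] by auto
    have Bm [measurable]: "B \<in> sets (borel \<Otimes>\<^sub>M borel)"
      using B(1) unfolding borel_prod .
    have D1: "?D1 = distr (density lborel ?s1) borel ?r1"
      by (rule volume_measure_chart[OF c ch(1) \<mu>1(1) meas(1)[OF c]])
    have D2: "?D2 = distr (density lborel ?s2) borel ?r2"
      by (rule volume_measure_chart[OF d ch(2) \<mu>2(1) meas(2)[OF d]])
    \<comment> \<open>The product rules below ask for sigma-finiteness in the second factor.\<close>
    have fin2: "finite_measure ?D2"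
    proof
      have "emeasure ?D2 (space ?D2) \<le> emeasure \<mu>2 (space \<mu>2)"
        by (subst emeasure_density)
          (auto simp: emeasure_space)
      then show "emeasure ?D2 (space ?D2) \<noteq> \<infinity>"
        using \<mu>2.emeasure_finite[of "space \<mu>2"] by (auto simp: top_unique)
    qed
    \<comment> \<open>Sigma-finiteness passes back from a push-forward to the measure
      upstairs.\<close>
    then have sf2: "sigma_finite_measure (density lborel ?s2)"
      unfolding D2 by (intro sigma_finite_measure_distr[of _ borel ?r2] finite_measure.axioms) auto
    have "emeasure (density (\<mu>1 \<Otimes>\<^sub>M \<mu>2) (\<lambda>(p, q). ennreal (g p))) B =
        (\<integral>\<^sup>+w. ?h w \<partial>(\<mu>1 \<Otimes>\<^sub>M \<mu>2))"
      using B(1) sets by (subst emeasure_density) (auto intro!: nn_integral_cong simp: split_beta)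
    \<comment> \<open>Restricting to the chart domains is free because \<open>B\<close> lies in
      their product.\<close>
    also have "\<dots> = (\<integral>\<^sup>+w. (case w of (p, q) \<Rightarrow> indicator (chart_dom c) p * indicator (chart_dom d) q) * ?h w
        \<partial>(\<mu>1 \<Otimes>\<^sub>M \<mu>2))"
      using B(2) by (intro nn_integral_cong) (auto split: split_indicator)
    also have "\<dots> = (\<integral>\<^sup>+w. ?h w \<partial>density (\<mu>1 \<Otimes>\<^sub>M \<mu>2)
        (\<lambda>(p, q). indicator (chart_dom c) p * indicator (chart_dom d) q))"
      by (intro nn_integral_density[symmetric]) measurable
    also have "\<dots> = (\<integral>\<^sup>+w. ?h w \<partial>(?D1 \<Otimes>\<^sub>M ?D2))"
      using fin2 by (subst pair_measure_density)
        (auto intro: \<mu>2.sigma_finite_measure_axioms finite_measure.axioms)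
    also have "\<dots> = (\<integral>\<^sup>+w. ?h w \<partial>distr (density lborel ?s1 \<Otimes>\<^sub>M density lborel ?s2)
        (borel \<Otimes>\<^sub>M borel) (\<lambda>(x, y). (?r1 x, ?r2 y)))"
      using fin2 unfolding D1 D2
      by (subst pair_measure_distr) (auto intro: finite_measure.axioms)
    also have "\<dots> = (\<integral>\<^sup>+w. ?h (case w of (x, y) \<Rightarrow> (?r1 x, ?r2 y))
        \<partial>(density lborel ?s1 \<Otimes>\<^sub>M density lborel ?s2))"
      by (intro nn_integral_distr) measurable
    also have "\<dots> = (\<integral>\<^sup>+w. ?h (case w of (x, y) \<Rightarrow> (?r1 x, ?r2 y))
        \<partial>density (lborel \<Otimes>\<^sub>M lborel) (\<lambda>(x, y). ?s1 x * ?s2 y))"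
      using sf2 by (subst pair_measure_density) (auto intro: lborel.sigma_finite_measure_axioms)
    also have "\<dots> = (\<integral>\<^sup>+w. (case w of (x, y) \<Rightarrow> ?s1 x * ?s2 y) *
        ?h (case w of (x, y) \<Rightarrow> (?r1 x, ?r2 y)) \<partial>(lborel \<Otimes>\<^sub>M lborel))"
      by (intro nn_integral_density) measurable
    \<comment> \<open>The integrand is rewritten as a function of \<open>vec_join x y\<close> alone,
      ready for the change of variables.\<close>
    also have "\<dots> = (\<integral>\<^sup>+w. ?s1 (vec_left (case w of (x, y) \<Rightarrow> vec_join x y)) *
        ?s2 (vec_right (case w of (x, y) \<Rightarrow> vec_join x y)) *
        ?h (?r1 (vec_left (case w of (x, y) \<Rightarrow> vec_join x y)),
          ?r2 (vec_right (case w of (x, y) \<Rightarrow> vec_join x y))) \<partial>lborel)"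
      unfolding lborel_prod by (intro nn_integral_cong) (auto simp: split_beta)
    also have "\<dots> = (\<integral>\<^sup>+z. ?s1 (vec_left z) * ?s2 (vec_right z) * ?h (?r1 (vec_left z), ?r2 (vec_right z))
        \<partial>distr lborel borel (\<lambda>(x, y). vec_join x y))"
    proof -
      have [measurable]: "vec_left \<in> borel_measurable (borel :: (real^('n + 'l)) measure)"
          "vec_right \<in> borel_measurable (borel :: (real^('n + 'l)) measure)"
        by (intro borel_measurable_continuous_onI linear_continuous_on bounded_linear_vec_left
            bounded_linear_vec_right)+
      have f: "(\<lambda>z. ?s1 (vec_left z) * ?s2 (vec_right z) * ?h (?r1 (vec_left z), ?r2 (vec_right z)))
          \<in> borel_measurable (borel :: (real^('n + 'l)) measure)"
        by measurable
      show ?thesis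
        by (rule nn_integral_distr[symmetric]) (use f in simp_all)
    qed
    also have "\<dots> = (\<integral>\<^sup>+z\<in>chart_map (prod_chart c d) ` B.
        ennreal (\<sigma> (prod_chart c d) (chart_inv (prod_chart c d) z)) \<partial>lborel)"
      unfolding lborel_vec_join
    proof (rule nn_integral_cong)
      fix z :: "real^('n + 'l)"
      obtain x y where z: "z = vec_join x y"
        by (metis vec_join_left_right)
      show "?s1 (vec_left z) * ?s2 (vec_right z) * ?h (?r1 (vec_left z), ?r2 (vec_right z)) =
        ennreal (\<sigma> (prod_chart c d) (chart_inv (prod_chart c d) z)) *
          indicator (chart_map (prod_chart c d) ` B) z"
      proof (cases "x \<in> chart_image c \<and> y \<in> chart_image d")
        case True
        then have inv: "chart_inv c x \<in> chart_dom c" "chart_inv d y \<in> chart_dom d"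
          using is_chart_inverse(3) ch by blast+
        have "\<sigma> (prod_chart c d) (chart_inv (prod_chart c d) z) =
            g (chart_inv c x) * \<sigma>1 c (chart_inv c x) * \<sigma>2 d (chart_inv d y)"
          using True unfolding z by (subst chart_inv_prod) (simp_all only: ch \<sigma> c d inv)
        then have "ennreal (\<sigma> (prod_chart c d) (chart_inv (prod_chart c d) z)) =
            ennreal (g (chart_inv c x)) *
              (ennreal (\<sigma>1 c (chart_inv c x)) * ennreal (\<sigma>2 d (chart_inv d y)))"
          using nonneg(1)[OF c inv(1)] nonneg(2)[OF d inv(2)] g(2)
          by (simp add: ennreal_mult mult.assoc)
        moreover have "z \<in> chart_map (prod_chart c d) ` B \<longleftrightarrow> (chart_inv c x, chart_inv d y) \<in> B"
        proof
          assume "z \<in> chart_map (prod_chart c d) ` B"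
          then obtain p q where "(p, q) \<in> B" "x = chart_map c p" "y = chart_map d q"
            by (auto simp: z)
          then show "(chart_inv c x, chart_inv d y) \<in> B"
            using B(2) is_chart_inverse(1)[OF ch(1)] is_chart_inverse(1)[OF ch(2)] by auto
        next
          assume "(chart_inv c x, chart_inv d y) \<in> B"
          then show "z \<in> chart_map (prod_chart c d) ` B"
            using True is_chart_inverse(2)[OF ch(1)] is_chart_inverse(2)[OF ch(2)]
            by (intro image_eqI[of _ _ "(chart_inv c x, chart_inv d y)"]) (auto simp: z)
        qed
        moreover have "chart_density c (\<sigma>1 c) (vec_left z) = \<sigma>1 c (chart_inv c x)"
            "chart_density d (\<sigma>2 d) (vec_right z) = \<sigma>2 d (chart_inv d y)"
            "?r1 (vec_left z) = chart_inv c x" "?r2 (vec_right z) = chart_inv d y"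
          using True by (simp_all add: z chart_density_def chart_param_def)
        ultimately show ?thesis
          by (simp add: indicator_def mult_ac)
      next
        \<comment> \<open>Here the zero extension of one density kills the left side, and the
          indicator kills the right.\<close>
        case False
        then have "z \<notin> chart_map (prod_chart c d) ` B"
          using B(2) by (auto simp: z)
        with False show ?thesis
          by (auto simp: z chart_density_def)
      qed
    qed
    finally show ?thesis .
  qed
  then show ?thesis
    using sets by (auto simp: is_volume_measure_def prod_atlas_def)
qed

text \<open>The measure just constructed is the witness: its density is bounded by \<open>b\<close>,
  so its total mass is at most \<open>b\<close> times the product of the two total masses.\<close>

lemma finite_volume_prod:
  fixes A1 :: "('m::{t2_space, second_countable_topology}, 'n::finite) chart set"
    and A2 :: "('k::{t2_space, second_countable_topology}, 'l::finite) chart set"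
  assumes charts: "\<And>c. c \<in> A1 \<Longrightarrow> is_chart c" "\<And>d. d \<in> A2 \<Longrightarrow> is_chart d"
    and fin: "finite_volume A1 \<sigma>1" "finite_volume A2 \<sigma>2"
    and meas: "\<And>c. c \<in> A1 \<Longrightarrow> chart_density c (\<sigma>1 c) \<in> borel_measurable borel"
      "\<And>d. d \<in> A2 \<Longrightarrow> chart_density d (\<sigma>2 d) \<in> borel_measurable borel"
    and nonneg: "\<And>c p. c \<in> A1 \<Longrightarrow> p \<in> chart_dom c \<Longrightarrow> 0 \<le> \<sigma>1 c p"
      "\<And>d q. d \<in> A2 \<Longrightarrow> q \<in> chart_dom d \<Longrightarrow> 0 \<le> \<sigma>2 d q"
    and g: "g \<in> borel_measurable borel" "\<And>p. 0 \<le> g p" "\<And>p. g p \<le> b"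
    and \<sigma>: "\<And>c d p q. c \<in> A1 \<Longrightarrow> p \<in> chart_dom c \<Longrightarrow> d \<in> A2 \<Longrightarrow> q \<in> chart_dom d \<Longrightarrow>
      \<sigma> (prod_chart c d) (p, q) = g p * \<sigma>1 c p * \<sigma>2 d q"
  shows "finite_volume (prod_atlas A1 A2) \<sigma>"
proof -
  obtain \<mu>1 \<mu>2 where \<mu>: "is_volume_measure A1 \<sigma>1 \<mu>1" "emeasure \<mu>1 UNIV < \<infinity>"
      "is_volume_measure A2 \<sigma>2 \<mu>2" "emeasure \<mu>2 UNIV < \<infinity>"
    using fin by (auto simp: finite_volume_def)
  then have sets1 [measurable_cong]: "sets \<mu>1 = sets borel" and sets2 [measurable_cong]: "sets \<mu>2 = sets borel"
    by (auto simp: is_volume_measure_def)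
  have space: "space \<mu>1 = UNIV" "space \<mu>2 = UNIV"
    using sets_eq_imp_space_eq[OF sets1] sets_eq_imp_space_eq[OF sets2] by auto
  have \<mu>1: "finite_measure \<mu>1" and \<mu>2: "finite_measure \<mu>2"
    using \<mu> by (auto intro!: finite_measureI simp: space)
  interpret \<mu>2: finite_measure \<mu>2 by fact
  let ?\<mu> = "density (\<mu>1 \<Otimes>\<^sub>M \<mu>2) (\<lambda>(p, q). ennreal (g p))"
  note [measurable] = g(1)
  have "emeasure ?\<mu> UNIV = (\<integral>\<^sup>+w. (case w of (p, q) \<Rightarrow> ennreal (g p)) \<partial>(\<mu>1 \<Otimes>\<^sub>M \<mu>2))"
    using sets.top[of "\<mu>1 \<Otimes>\<^sub>M \<mu>2"]
    by (subst emeasure_density) (auto simp: space_pair_measure space intro!: nn_integral_cong)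
  also have "\<dots> \<le> (\<integral>\<^sup>+w. ennreal b \<partial>(\<mu>1 \<Otimes>\<^sub>M \<mu>2))"
    using g(3) by (intro nn_integral_mono) (auto intro: ennreal_leI)
  also have "\<dots> = ennreal b * (emeasure \<mu>1 UNIV * emeasure \<mu>2 UNIV)"
    using \<mu>2.emeasure_pair_measure_Times[of UNIV \<mu>1 UNIV] sets1 sets2
    by (simp add: space_pair_measure space)
  also have "\<dots> < \<infinity>"
    using \<mu>(2,4) by (simp add: ennreal_mult_less_top)
  finally show ?thesis
    unfolding finite_volume_def
    using is_volume_measure_prod[OF charts \<mu>(1) \<mu>1 \<mu>(3) \<mu>2 meas nonneg g(1,2) \<sigma>] by blast
qed

section \<open>Continuity of the warping function and finiteness of the warped volume\<close>

lemma smooth_function_continuous: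
  assumes A: "differentiable_atlas A" and f: "smooth_function A f"
  shows "continuous_on UNIV f"
proof -
  have "continuous_on (chart_dom c) f" if c: "c \<in> A" for c
  proof -
    have ch: "is_chart c"
      using atlas_chart[OF A c] .
    have "smooth_on (chart_image c) (f \<circ> chart_inv c)"
      using f c by (auto simp: smooth_function_def)
    then have "continuous_on (chart_image c) (f \<circ> chart_inv c)"
      unfolding smooth_on_def by (drule_tac spec[of _ 0]) simp
    from continuous_on_compose2[OF this is_chart_continuous(1)[OF ch] order_refl]
    show ?thesis
      by (rule continuous_on_eq) (simp add: is_chart_inverse[OF ch])
  qed
  then have "continuous_on (\<Union>c\<in>A. chart_dom c) f"
    using atlas_chart[OF A] by (intro continuous_on_open_UN) (auto simp: is_chart_open)
  then show ?thesis
    using A by (simp add: differentiable_atlas_def)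
qed

theorem theorem6:
  fixes A1 :: "('m::{t2_space, second_countable_topology}, 'n::finite) chart set"
    and F1 :: "('m, 'n) tm_fun"
    and A2 :: "('k::{t2_space, second_countable_topology}, 'l::finite) chart set"
    and F2 :: "('k, 'l) tm_fun"
    and f :: "'m \<Rightarrow> real" and a b :: real
  assumes "smooth_atlas A1" and "finsler_metric A1 F1"
    and "smooth_atlas A2" and "finsler_metric A2 F2"
    and "smooth_function A1 f"
    and "0 < a" and "0 < b" and "\<And>p. a \<le> f p \<and> f p \<le> b"
  shows "(finite_max_volume A1 (slit_tangent A1) F1 \<and> finite_max_volume A2 (slit_tangent A2) F2 \<longrightarrow>
          finite_max_volume (prod_atlas A1 A2) (warped_slit_tangent A1 A2)
            (warped_metric A1 F1 f A2 F2))
       \<and> (finite_min_volume A1 (slit_tangent A1) F1 \<and> finite_min_volume A2 (slit_tangent A2) F2 \<longrightarrow>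
          finite_min_volume (prod_atlas A1 A2) (warped_slit_tangent A1 A2)
            (warped_metric A1 F1 f A2 F2))"
proof -
  note A1 = smooth_atlas_differentiable[OF assms(1)] and A2 = smooth_atlas_differentiable[OF assms(3)]
  note F1 = \<open>finsler_metric A1 F1\<close> and F2 = \<open>finsler_metric A2 F2\<close>
  \<comment> \<open>The lower bound supplies the positivity of the warping function, the upper bound
    the control of the total mass.\<close>
  have f: "0 < f p" "f p \<le> b" for p
    using assms(6) assms(8)[of p] by auto
  have g: "(\<lambda>p. f p ^ CARD('l)) \<in> borel_measurable borel" "0 \<le> f p ^ CARD('l)"
      "f p ^ CARD('l) \<le> b ^ CARD('l)" for p
    using borel_measurable_continuous_onI[OF smooth_function_continuous[OF A1 assms(5)]]
      f[of p] by (auto intro: power_mono)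
  have "finite_max_volume (prod_atlas A1 A2) (warped_slit_tangent A1 A2) (warped_metric A1 F1 f A2 F2)"
    if "finite_max_volume A1 (slit_tangent A1) F1" "finite_max_volume A2 (slit_tangent A2) F2"
    unfolding finite_max_volume_def
  proof (rule finite_volume_prod[OF atlas_chart[OF A1] atlas_chart[OF A2]
        that[unfolded finite_max_volume_def] _ _ _ _ g])
  \<comment> \<open>What remains is measurability and nonnegativity of the two factor densities and
    the product formula for the warped density.\<close>
  qed (auto simp: chart_density_def[abs_def] borel_measurable_sigma_max[OF A1 F1]
      borel_measurable_sigma_max[OF A2 F2] less_imp_le[OF sigma_slit_pos(1)[OF A1 F1]]
      less_imp_le[OF sigma_slit_pos(1)[OF A2 F2]] warped_sigma_max[OF A1 F1 A2 F2 f(1)])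
  moreover have "finite_min_volume (prod_atlas A1 A2) (warped_slit_tangent A1 A2) (warped_metric A1 F1 f A2 F2)"
    if "finite_min_volume A1 (slit_tangent A1) F1" "finite_min_volume A2 (slit_tangent A2) F2"
    unfolding finite_min_volume_def
  proof (rule finite_volume_prod[OF atlas_chart[OF A1] atlas_chart[OF A2]
        that[unfolded finite_min_volume_def] _ _ _ _ g])
  qed (auto simp: chart_density_def[abs_def] borel_measurable_sigma_min[OF A1 F1]
      borel_measurable_sigma_min[OF A2 F2] less_imp_le[OF sigma_slit_pos(2)[OF A1 F1]]
      less_imp_le[OF sigma_slit_pos(2)[OF A2 F2]] warped_sigma_min[OF A1 F1 A2 F2 f(1)])
  ultimately show ?thesis
    by blast
qed

end
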